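(* Let $\varepsilon \in (0,1)$. There exists $P_0 = P_0(\varepsilon)$ such that for every real $p_0 \geq P_0$ the following holds. Let $X, Y, D \in [1,\infty)$ with $D \leq \min(X,Y)$, and let $\delta \in (0,1]$. Suppose that $A \subset [X,2X]$ and $B \subset [Y,2Y]$ are sets of integers such that $\gcd(a,b) \geq D$ for at least $\delta |A||B|$ pairs $(a,b) \in A \times B$. Then \[ |A||B| \leq 1000^{\,1 + \#\mathscr{P}_{\mathrm{sml}}(A \cup B)}\, \delta^{-2-\varepsilon}\, \frac{XY}{D^2}, \] where $\mathscr{P}_{\mathrm{sml}}(A\cup B)$ is the set of primes $p \leq p_0$ dividing some element of $A \cup B$.
   Context: For a finite set $S \subset \mathbf{N}$, $\mathscr{P}_{\mathrm{sml}}(S)$ denotes the set of primes $p \leq p_0$ that divide at least one element of $S$; here $p_0$ is a threshold taken sufficiently large in terms of $\varepsilon$. *)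

theory Defs
  imports Complex_Main "HOL-Computational_Algebra.Primes"
begin

definition P_sml :: "real \<Rightarrow> nat set \<Rightarrow> nat set" where
  "P_sml p0 S = {p. prime p \<and> real p \<le> p0 \<and> (\<exists>s\<in>S. p dvd s)}"

end

theory Submission
  imports Defs "HOL-Analysis.Convex" "HOL-Analysis.Summation_Tests"
begin

text \<open>
  Put \<open>s = 1 / (2 + \<epsilon>)\<close>, \<open>K = X Y / D\<^sup>2\<close>, and let \<open>E\<close> be the set of pairs with large gcd. One proves
  \<open>|E| \<le> (C K)\<^sup>s (|A| |B|)\<^bsup>1-s\<^esup>\<close> by induction on the number of primes dividing an element of
  \<open>A \<union> B\<close>. Fixing a prime \<open>p\<close> and restricting to \<open>v\<^sub>p(a) = i\<close>, \<open>v\<^sub>p(b) = j\<close>, one may divide \<open>p\<close> out,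
  which improves the bound for that fibre by \<open>p\<^bsup>-s|i-j|\<^esup>\<close>. For a small prime the fibres are
  summed by Schur's test, at the cost of a factor at most 1000 in \<open>C\<close>.

  If all primes are large and the bound fails, then the fibre densities
  \<open>\<alpha>\<^sub>i\<close>, \<open>\<beta>\<^sub>j\<close> of \<open>A\<close>, \<open>B\<close> satisfy \<open>1 \<le> \<Sum> p\<^bsup>-s|i-j|\<^esup> (\<alpha>\<^sub>i \<beta>\<^sub>j)\<^bsup>1-s\<^esup>\<close>. This forces both densities to
  concentrate on one common exponent \<open>k\<^sub>p\<close> up to \<open>O(1/p)\<close>, and the pairs with \<open>v\<^sub>p(a) \<noteq> k\<^sub>p \<noteq> v\<^sub>p(b)\<close>
  have proportion \<open>O(p\<^bsup>-2(1-s)\<^esup>)\<close> in \<open>E\<close>. As \<open>2(1-s) > 1\<close>, deleting these for all \<open>p\<close> keeps at least half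
  of \<open>E\<close>. With \<open>N = \<Prod> p ^ k\<^sub>p\<close> and \<open>n\<^sub>a = N / gcd(N,a)\<close>, the remaining pairs satisfy
  \<open>gcd(a,b) n\<^sub>a n\<^sub>b \<le> N\<close>, so \<open>n\<^sub>a n\<^sub>b \<le> N / D\<close>, whereas \<open>n\<^sub>a \<le> x\<close> holds for at most \<open>X x\<^sup>2 / N\<close>
  elements of \<open>A\<close>; hence at most \<open>2 \<surd>(K |A| |B|)\<close> pairs remain, which contradicts the failure of the bound.
\<close>

subsection \<open>Inequalities for finite sums\<close>

text \<open>With truncated subtraction, \<open>t^(i-j) * t^(j-i)\<close> encodes \<open>t\<close> to the power \<open>|i - j|\<close>.\<close>

lemma sum_power_abs_diff_le:
  fixes t :: real and J :: "nat set"
  assumes "finite J" "0 \<le> t" "t < 1"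
  shows "(\<Sum>j\<in>J. t^(i-j) * t^(j-i)) \<le> (1 + t) / (1 - t)"
    and "(\<Sum>j\<in>J-{i}. t^(i-j) * t^(j-i)) \<le> 2 * t / (1 - t)"
proof -
  have geo: "(\<Sum>j\<in>S. t ^ j) \<le> 1 / (1 - t)" if "finite S" for S :: "nat set"
  proof -
    have "(\<Sum>j\<in>S. t ^ j) \<le> (\<Sum>j. t ^ j)"
      using assms that by (intro sum_le_suminf summable_geometric) auto
    then show ?thesis using assms by (simp add: suminf_geometric)
  qed
  \<comment> \<open>Here \<open>f\<close> is the distance to \<open>i\<close> on one side of
    \<open>i\<close>. It is injective and positive there, so taking out one factor \<open>t\<close>
    leaves distinct powers of \<open>t\<close>.\<close>
  have part: "(\<Sum>j\<in>S. t ^ f j) \<le> t / (1 - t)"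
    if "finite S" "inj_on f S" "\<And>j. j \<in> S \<Longrightarrow> f j > 0" for f :: "nat \<Rightarrow> nat" and S
  proof -
    have inj: "inj_on (\<lambda>j. f j - 1) S"
      using that by (intro inj_onI) (metis Suc_pred' inj_onD)
    have "(\<Sum>j\<in>S. t ^ f j) = (\<Sum>j\<in>S. t * t ^ (f j - 1))"
      using that(3) by (intro sum.cong refl) (metis Suc_pred' power_Suc)
    also have "\<dots> = t * (\<Sum>j\<in>(\<lambda>j. f j - 1) ` S. t ^ j)"
      using inj by (simp add: sum.reindex sum_distrib_left)
    also have "\<dots> \<le> t * (1 / (1 - t))"
      using geo[of "(\<lambda>j. f j - 1) ` S"] that(1) assms(2) by (intro mult_left_mono) auto
    finally show ?thesis by simp
  qed
  have "(\<Sum>j\<in>J-{i}. t^(i-j) * t^(j-i))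
      = (\<Sum>j\<in>{j\<in>J. j < i} \<union> {j\<in>J. j > i}. t^(i-j) * t^(j-i))"
    by (rule sum.cong) auto
  also have "\<dots> = (\<Sum>j\<in>{j\<in>J. j < i}. t^(i-j)) + (\<Sum>j\<in>{j\<in>J. j > i}. t^(j-i))"
    using assms by (subst sum.union_disjoint) (auto intro!: sum.cong)
  also have "\<dots> \<le> t / (1 - t) + t / (1 - t)"
    using assms by (intro add_mono part) (auto simp: inj_on_def)
  finally show off: "(\<Sum>j\<in>J-{i}. t^(i-j) * t^(j-i)) \<le> 2 * t / (1 - t)"
    by simp
  have "(\<Sum>j\<in>J. t^(i-j) * t^(j-i)) \<le> 1 + (\<Sum>j\<in>J-{i}. t^(i-j) * t^(j-i))"
    using assms by (cases "i \<in> J") (auto simp: sum.remove)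
  also have "\<dots> \<le> 1 + 2 * t / (1 - t)" using off by simp
  finally show "(\<Sum>j\<in>J. t^(i-j) * t^(j-i)) \<le> (1 + t) / (1 - t)"
    using assms by (simp add: field_simps)
qed

text \<open>After normalising both masses to 1, every product \<open>x * y\<close> is at most 1.
  Since \<open>1/2 \<le> r\<close>, its power is at most its square root, hence at most the mean of
  \<open>x\<close> and \<open>y\<close>. This separates the variables, so that only row and column
  sums of \<open>M\<close> enter.\<close>

lemma schur_test_powr:
  fixes M :: "'a \<Rightarrow> 'b \<Rightarrow> real"
  assumes fin: "finite I" "finite J" and r: "1/2 \<le> r"
    and \<alpha>: "\<And>i. i \<in> I \<Longrightarrow> 0 \<le> \<alpha> i" and \<beta>: "\<And>j. j \<in> J \<Longrightarrow> 0 \<le> \<beta> j"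
    and M: "\<And>i j. i \<in> I \<Longrightarrow> j \<in> J \<Longrightarrow> 0 \<le> M i j"
    and row: "\<And>i. i \<in> I \<Longrightarrow> (\<Sum>j\<in>J. M i j) \<le> S"
    and col: "\<And>j. j \<in> J \<Longrightarrow> (\<Sum>i\<in>I. M i j) \<le> S"
  shows "(\<Sum>i\<in>I. \<Sum>j\<in>J. M i j * (\<alpha> i * \<beta> j) powr r) \<le> S * (sum \<alpha> I * sum \<beta> J) powr r"
proof (cases "sum \<alpha> I = 0 \<or> sum \<beta> J = 0")
  case True
  then have "(\<Sum>i\<in>I. \<Sum>j\<in>J. M i j * (\<alpha> i * \<beta> j) powr r) = 0"
    using fin \<alpha> \<beta> by (auto simp: sum_nonneg_eq_0_iff intro!: sum.neutral)
  with True show ?thesis by auto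
next
  case False
  define a b where "a = sum \<alpha> I" and "b = sum \<beta> J"
  have ab: "a > 0" "b > 0"
    using False \<alpha> \<beta> by (auto simp: a_def b_def order_less_le sum_nonneg)
  have pt: "(\<alpha> i * \<beta> j) powr r \<le> (a * b) powr r * ((\<alpha> i / a + \<beta> j / b) / 2)"
    if ij: "i \<in> I" "j \<in> J" for i j
  proof -
    define x y where "x = \<alpha> i / a" and "y = \<beta> j / b"
    have "x \<le> 1" "y \<le> 1" "0 \<le> x" "0 \<le> y"
      using ij fin \<alpha> \<beta> ab by (auto simp: x_def y_def a_def b_def intro!: member_le_sum)
    then have "(x * y) powr r \<le> (x * y) powr (1/2)"
      using r by (intro powr_mono') (auto simp: mult_le_one)
    also have "\<dots> = sqrt (x * y)"
      using \<open>0 \<le> x\<close> \<open>0 \<le> y\<close> by (simp add: powr_half_sqrt)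
    also have "\<dots> \<le> (x + y) / 2"
      using \<open>0 \<le> x\<close> \<open>0 \<le> y\<close> by (rule arith_geo_mean_sqrt)
    finally have "(a * b) powr r * (x * y) powr r \<le> (a * b) powr r * ((x + y) / 2)"
      by (intro mult_left_mono) auto
    moreover have "(a * b) powr r * (x * y) powr r = (\<alpha> i * \<beta> j) powr r"
      using ab \<open>0 \<le> x\<close> \<open>0 \<le> y\<close> by (subst powr_mult [symmetric]) (auto simp: x_def y_def field_simps)
    ultimately show ?thesis by (simp add: x_def y_def)
  qed
  have "(\<Sum>i\<in>I. \<Sum>j\<in>J. M i j * (\<alpha> i * \<beta> j) powr r)
     \<le> (\<Sum>i\<in>I. \<Sum>j\<in>J. M i j * ((a * b) powr r * ((\<alpha> i / a + \<beta> j / b) / 2)))"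
    using pt M by (intro sum_mono mult_left_mono) auto
  also have "\<dots> = (a * b) powr r / 2 * ((\<Sum>i\<in>I. \<alpha> i / a * (\<Sum>j\<in>J. M i j))
      + (\<Sum>j\<in>J. \<beta> j / b * (\<Sum>i\<in>I. M i j)))"
  proof -
    have "(\<Sum>j\<in>J. \<beta> j / b * (\<Sum>i\<in>I. M i j)) = (\<Sum>i\<in>I. \<Sum>j\<in>J. \<beta> j / b * M i j)"
      by (subst sum.swap) (simp add: sum_distrib_left)
    then show ?thesis
      unfolding sum_distrib_left sum.distrib [symmetric]
      by (simp only: sum.distrib [symmetric] sum_distrib_left) (intro sum.cong refl, simp add: field_simps)
  qed
  also have "\<dots> \<le> (a * b) powr r / 2 * ((\<Sum>i\<in>I. \<alpha> i / a * S) + (\<Sum>j\<in>J. \<beta> j / b * S))"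
    using row col \<alpha> \<beta> ab by (intro mult_left_mono add_mono sum_mono) auto
  also have "\<dots> = S * (a * b) powr r"
    using ab by (simp add: sum_distrib_right [symmetric] sum_divide_distrib [symmetric] a_def b_def)
  finally show ?thesis by (simp add: a_def b_def)
qed

text \<open>Hoelder's inequality with exponents \<open>1 / s\<close> and \<open>1 / (1 - s)\<close>,
  obtained by normalising both sums and applying the weighted mean inequality to each term.\<close>

lemma sum_powr_mult_powr_le:
  fixes w b :: "'a \<Rightarrow> real"
  assumes "finite J" "0 < s" "s < 1" "\<And>j. j \<in> J \<Longrightarrow> 0 < w j" "\<And>j. j \<in> J \<Longrightarrow> 0 \<le> b j"
  shows "(\<Sum>j\<in>J. w j powr s * b j powr (1 - s)) \<le> sum w J powr s * sum b J powr (1 - s)"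
proof (cases "sum b J = 0")
  case True
  then show ?thesis using assms by (auto simp: sum_nonneg_eq_0_iff intro!: sum_nonpos)
next
  case False
  then have y: "sum b J > 0" using assms by (simp add: order_less_le sum_nonneg)
  have "J \<noteq> {}" using False by auto
  then have W: "sum w J > 0" using assms by (intro sum_pos) auto
  define W y where "W = sum w J" and "y = sum b J"
  have Wy: "W > 0" "y > 0" using W y by (simp_all add: W_def y_def)
  have pt: "w j powr s * b j powr (1 - s) \<le> W powr s * y powr (1 - s) * (s * (w j / W) + (1 - s) * (b j / y))"
    if "j \<in> J" for j
  proof -
    have "(w j / W) powr s * (b j / y) powr (1 - s) \<le> s * (w j / W) + (1 - s) * (b j / y)"
    proof (cases "b j = 0")
      case True
      then show ?thesis using assms that Wy by (simp add: less_imp_le)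
    next
      case False
      then have "b j > 0" using assms(5)[OF that] by simp
      then show ?thesis using assms that Wy by (intro Youngs_inequality_0) auto
    qed
    moreover have "W powr s * y powr (1 - s) * ((w j / W) powr s * (b j / y) powr (1 - s))
        = w j powr s * b j powr (1 - s)"
      using Wy assms that by (simp add: powr_divide less_imp_le)
    ultimately show ?thesis
      by (smt (verit) mult_left_mono mult_nonneg_nonneg powr_ge_zero)
  qed
  have "(\<Sum>j\<in>J. w j powr s * b j powr (1 - s))
      \<le> (\<Sum>j\<in>J. W powr s * y powr (1 - s) * (s * (w j / W) + (1 - s) * (b j / y)))"
    using pt by (rule sum_mono)
  also have "\<dots> = W powr s * y powr (1 - s) * (s * (sum w J / W) + (1 - s) * (sum b J / y))"
    by (simp only: sum_divide_distrib sum_distrib_left sum.distrib [symmetric])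
  also have "\<dots> = W powr s * y powr (1 - s)"
    using Wy by (simp add: W_def y_def)
  finally show ?thesis by (simp add: W_def y_def)
qed

text \<open>Without ties the ranks are 1, ..., n, and the sum of \<open>1 / sqrt m\<close> is at
  most \<open>2 * sqrt n\<close>; ties only raise ranks. The induction removes an element with
  maximal \<open>f\<close>, whose rank is \<open>card A\<close>.\<close>

lemma sum_inverse_sqrt_rank_le:
  fixes f :: "'a \<Rightarrow> 'b::linorder"
  assumes "finite A"
  shows "(\<Sum>a\<in>A. 1 / sqrt (card {a'\<in>A. f a' \<le> f a})) \<le> 2 * sqrt (card A)"
  using assms
proof (induction "card A" arbitrary: A)
  case 0
  then show ?case by simp
next
  case (Suc n)
  then have "A \<noteq> {}" by auto
  then obtain m where m: "m \<in> A" "\<And>a. a \<in> A \<Longrightarrow> f a \<le> f m"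
    using Max_in[of "f ` A"] Max_ge[of "f ` A"] Suc.prems by (smt (verit) finite_imageI imageE imageI image_is_empty)
  have cA: "card A = n + 1" "card (A - {m}) = n" using Suc m by auto
  have rank: "{a'\<in>A. f a' \<le> f m} = A" using m by auto
  have "(\<Sum>a\<in>A. 1 / sqrt (card {a'\<in>A. f a' \<le> f a}))
     = 1 / sqrt (n + 1) + (\<Sum>a\<in>A-{m}. 1 / sqrt (card {a'\<in>A. f a' \<le> f a}))"
    using Suc.prems m cA by (simp add: sum.remove rank)
  also have "(\<Sum>a\<in>A-{m}. 1 / sqrt (card {a'\<in>A. f a' \<le> f a}))
     \<le> (\<Sum>a\<in>A-{m}. 1 / sqrt (card {a'\<in>A-{m}. f a' \<le> f a}))"
  proof (rule sum_mono)
    fix a assume a: "a \<in> A - {m}"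
    have "card {a'\<in>A-{m}. f a' \<le> f a} > 0"
      using a Suc.prems by (auto simp: card_gt_0_iff)
    moreover have "card {a'\<in>A-{m}. f a' \<le> f a} \<le> card {a'\<in>A. f a' \<le> f a}"
      using Suc.prems by (intro card_mono) auto
    ultimately show "1 / sqrt (card {a'\<in>A. f a' \<le> f a}) \<le> 1 / sqrt (card {a'\<in>A-{m}. f a' \<le> f a})"
      by (intro divide_left_mono) auto
  qed
  also have "\<dots> \<le> 2 * sqrt n"
    using Suc.hyps(1)[of "A - {m}"] Suc.prems cA by simp
  also have "1 / sqrt (n + 1) + 2 * sqrt n \<le> 2 * sqrt (n + 1)"
  proof -
    have "2 * sqrt n * sqrt (n+1) \<le> n + (n + 1)"
      using arith_geo_mean_sqrt[of n "n+1"] by (simp add: real_sqrt_mult)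
    then show ?thesis by (simp add: field_simps)
  qed
  finally show ?case using cA by simp
qed

subsection \<open>Pairs whose valuations agree with a fixed integer\<close>

text \<open>The degree of \<open>a\<close> is at most \<open>card B\<close>. It is also at most
  \<open>c2 * (T / f a)\<^sup>2\<close>, and multiplying by the rank of \<open>a\<close>, which is
  at most \<open>c1 * (f a)\<^sup>2\<close>, cancels \<open>f a\<close>. The geometric mean of the
  two degree bounds is a constant over the square root of the rank, which can be summed over
  \<open>A\<close>.\<close>

lemma card_pairs_le_if_rank_le:
  fixes f :: "'a \<Rightarrow> real" and g :: "'b \<Rightarrow> real"
  assumes fin: "finite A" "finite B" and E: "E \<subseteq> A \<times> B"
    and nn: "0 \<le> c1" "0 \<le> c2" "0 \<le> T"
    and f: "\<And>a. a \<in> A \<Longrightarrow> 0 < f a"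
    and A: "\<And>x. real (card {a\<in>A. f a \<le> x}) \<le> c1 * x\<^sup>2"
    and B: "\<And>x. real (card {b\<in>B. g b \<le> x}) \<le> c2 * x\<^sup>2"
    and T: "\<And>a b. (a, b) \<in> E \<Longrightarrow> f a * g b \<le> T"
  shows "real (card E) \<le> 2 * sqrt (c1 * c2 * T\<^sup>2 * (card A * card B))"
proof -
  define R where "R = c1 * c2 * T\<^sup>2"
  define r where "r a = real (card {a'\<in>A. f a' \<le> f a})" for a
  have deg: "real (card {b. (a, b) \<in> E}) \<le> sqrt (card B * R) * (1 / sqrt (r a))" if a: "a \<in> A" for a
  proof -
    have r0: "r a > 0" using a fin by (auto simp: r_def card_gt_0_iff)
    have sub: "{b. (a, b) \<in> E} \<subseteq> B" using E by auto
    have 1: "real (card {b. (a, b) \<in> E}) \<le> card B"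
      using fin sub by (simp add: card_mono)
    have "card {b. (a, b) \<in> E} \<le> card {b\<in>B. g b \<le> T / f a}"
      using fin E T f[OF a] by (intro card_mono) (auto simp: field_simps)
    also have "real \<dots> \<le> c2 * (T / f a)\<^sup>2" by (rule B)
    finally have "real (card {b. (a, b) \<in> E}) * r a \<le> c2 * (T / f a)\<^sup>2 * (c1 * (f a)\<^sup>2)"
      using A[of "f a"] nn by (intro mult_mono) (auto simp: r_def)
    also have "\<dots> = R" using f[OF a] by (simp add: R_def field_simps)
    finally have 2: "real (card {b. (a, b) \<in> E}) \<le> R / r a" using r0 by (simp add: field_simps)
    have "(real (card {b. (a, b) \<in> E}))\<^sup>2 \<le> card B * (R / r a)"
      unfolding power2_eq_square using 1 2 by (intro mult_mono) auto
    then have "real (card {b. (a, b) \<in> E}) \<le> sqrt (card B * (R / r a))"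
      by (rule real_le_rsqrt)
    then show ?thesis by (simp add: real_sqrt_mult real_sqrt_divide)
  qed
  have "E = Sigma A (\<lambda>a. {b. (a, b) \<in> E})" using E by auto
  then have "card E = card (Sigma A (\<lambda>a. {b. (a, b) \<in> E}))" by simp
  also have "\<dots> = (\<Sum>a\<in>A. card {b. (a, b) \<in> E})"
    using fin E by (intro card_SigmaI) (auto intro: finite_subset[of _ B])
  finally have "real (card E) = (\<Sum>a\<in>A. real (card {b. (a, b) \<in> E}))" by simp
  also have "\<dots> \<le> (\<Sum>a\<in>A. sqrt (card B * R) * (1 / sqrt (r a)))"
    using deg by (rule sum_mono)
  also have "\<dots> = sqrt (card B * R) * (\<Sum>a\<in>A. 1 / sqrt (r a))"
    by (simp only: sum_distrib_left)
  also have "\<dots> \<le> sqrt (card B * R) * (2 * sqrt (card A))"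
    unfolding r_def using nn sum_inverse_sqrt_rank_le[OF fin(1), of f]
    by (intro mult_left_mono) (auto simp: R_def)
  finally show ?thesis by (simp add: R_def real_sqrt_mult mult_ac)
qed

lemma card_nat_le_real:
  assumes "finite S" "\<And>m. m \<in> S \<Longrightarrow> 0 < m \<and> real m \<le> x"
  shows "real (card S) \<le> max x 0"
proof -
  have "S \<subseteq> {0<..nat \<lfloor>x\<rfloor>}" using assms(2) by (auto simp: le_nat_floor)
  then have "card S \<le> nat \<lfloor>x\<rfloor>" using card_mono[of "{0<..nat \<lfloor>x\<rfloor>}" S] by simp
  then show ?thesis by linarith
qed

text \<open>If the cofactor equals \<open>n\<close>, then \<open>a\<close> is \<open>N / n\<close>
  times an integer of size at most \<open>X * n / N\<close>, and this integer determines
  \<open>a\<close>. Summing over the at most \<open>x\<close> values of \<open>n\<close> produces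
  the square.\<close>

lemma card_div_gcd_le:
  fixes A :: "nat set" and N :: nat
  assumes fin: "finite A" and A: "\<And>a. a \<in> A \<Longrightarrow> 0 < a \<and> real a \<le> X" and N: "N > 0" and X: "X \<ge> 0"
  shows "real (card {a\<in>A. real (N div gcd N a) \<le> x}) \<le> X / N * x\<^sup>2"
proof -
  define F where "F n = {a\<in>A. N div gcd N a = n}" for n
  define M where "M = nat \<lfloor>x\<rfloor>"
  have pos: "0 < N div gcd N a" for a
    using N by (simp add: div_greater_zero_iff gcd_le1_nat)
  have F: "real (card (F n)) \<le> X / N * n" for n
  proof -
    have *: "a * n = N * (a div gcd N a)" if "a \<in> F n" for a
      using that by (auto simp: F_def) (metis dvd_div_mult gcd_dvd1 gcd_dvd2 mult.commute)
    have inj: "inj_on (\<lambda>a. a div gcd N a) (F n)"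
    proof (rule inj_onI)
      fix a b assume ab: "a \<in> F n" "b \<in> F n" "a div gcd N a = b div gcd N b"
      then have "a * n = b * n" using * by metis
      moreover have "n > 0" using ab(1) pos by (auto simp: F_def)
      ultimately show "a = b" by simp
    qed
    have "real (card (F n)) = real (card ((\<lambda>a. a div gcd N a) ` F n))"
      using inj by (simp add: card_image)
    also have "\<dots> \<le> max (X / N * n) 0"
    proof (rule card_nat_le_real)
      show "finite ((\<lambda>a. a div gcd N a) ` F n)" using fin by (simp add: F_def)
      fix m assume "m \<in> (\<lambda>a. a div gcd N a) ` F n"
      then obtain a where a: "a \<in> F n" "m = a div gcd N a" by auto
      have "0 < m" using a A by (auto simp: F_def div_greater_zero_iff gcd_le2_nat)
      have "real N * real m = real a * real n" using *[OF a(1)] a(2) by (metis of_nat_mult)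
      also have "\<dots> \<le> X * n" using a A by (intro mult_right_mono) (auto simp: F_def)
      finally show "0 < m \<and> real m \<le> X / N * n" using \<open>0 < m\<close> N by (simp add: field_simps)
    qed
    also have "\<dots> = X / N * n" using X by simp
    finally show ?thesis .
  qed
  have "{a\<in>A. real (N div gcd N a) \<le> x} \<subseteq> (\<Union>n\<in>{0<..M}. F n)"
    using pos by (auto simp: F_def M_def le_nat_floor)
  then have "card {a\<in>A. real (N div gcd N a) \<le> x} \<le> card (\<Union>n\<in>{0<..M}. F n)"
    using fin by (intro card_mono) (auto simp: F_def)
  also have "\<dots> \<le> (\<Sum>n\<in>{0<..M}. card (F n))"
    by (rule card_UN_le) simp
  finally have "real (card {a\<in>A. real (N div gcd N a) \<le> x}) \<le> real (\<Sum>n\<in>{0<..M}. card (F n))"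
    by (rule of_nat_mono)
  then have "real (card {a\<in>A. real (N div gcd N a) \<le> x}) \<le> (\<Sum>n\<in>{0<..M}. real (card (F n)))"
    by simp
  also have "\<dots> \<le> (\<Sum>n\<in>{0<..M}. X / N * M)"
    using X by (intro sum_mono order_trans[OF F] mult_left_mono) auto
  also have "\<dots> = X / N * (real M)\<^sup>2" by (simp add: power2_eq_square)
  also have "\<dots> \<le> X / N * x\<^sup>2"
  proof -
    have "real M \<le> \<bar>x\<bar>" unfolding M_def by linarith
    then have "(real M)\<^sup>2 \<le> x\<^sup>2" by (metis abs_le_square_iff abs_of_nat)
    then show ?thesis using X by (intro mult_left_mono) auto
  qed
  finally show ?thesis .
qed

text \<open>Compare valuations at each prime. If \<open>a\<close> has the same valuation v as
  \<open>N\<close>, its cofactor contributes 0, while the gcd contributes min(v, w) and the cofactor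
  of \<open>b\<close> contributes v - min(v, w), where w is the valuation of \<open>b\<close>. The
  total is v.\<close>

lemma gcd_mult_cofactors_dvd:
  fixes a b N :: nat
  assumes pos: "a > 0" "b > 0" "N > 0"
    and mult: "\<And>p. prime p \<Longrightarrow> multiplicity p a = multiplicity p N \<or> multiplicity p b = multiplicity p N"
  shows "gcd a b * (N div gcd N a) * (N div gcd N b) dvd N"
proof (rule multiplicity_le_imp_dvd)
  have nz: "N div gcd N a \<noteq> 0" "N div gcd N b \<noteq> 0"
    using pos by (simp_all add: div_eq_0_iff gcd_le1_nat not_less)
  then show "gcd a b * (N div gcd N a) * (N div gcd N b) \<noteq> 0" using pos by simp
  fix p :: nat assume p: "prime p"
  have m: "multiplicity p (N div gcd N c) = multiplicity p N - min (multiplicity p N) (multiplicity p c)"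
    if c: "c > 0" for c
  proof -
    have "multiplicity p N = multiplicity p (N div gcd N c * gcd N c)" by simp
    also have "\<dots> = multiplicity p (N div gcd N c) + multiplicity p (gcd N c)"
      using p pos c by (intro prime_elem_multiplicity_mult_distrib)
        (auto simp: div_eq_0_iff gcd_le1_nat not_less)
    also have "multiplicity p (gcd N c) = min (multiplicity p N) (multiplicity p c)"
      using pos c p by (intro multiplicity_gcd) auto
    finally show ?thesis by simp
  qed
  have "multiplicity p (gcd a b * (N div gcd N a) * (N div gcd N b))
     = multiplicity p (gcd a b) + multiplicity p (N div gcd N a) + multiplicity p (N div gcd N b)"
    using p pos nz by (simp add: prime_elem_multiplicity_mult_distrib)
  also have "multiplicity p (gcd a b) = min (multiplicity p a) (multiplicity p b)"
    using pos p by (intro multiplicity_gcd) auto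
  finally show "multiplicity p (gcd a b * (N div gcd N a) * (N div gcd N b)) \<le> multiplicity p N"
    using mult[OF p] by (auto simp: m pos)
qed

text \<open>Rank the elements by their cofactors \<open>N div gcd N a\<close>. The product of two
  cofactors is at most \<open>N / D\<close> along \<open>E\<close>, while the two counting bounds
  carry \<open>X / N\<close> and \<open>Y / N\<close>, so \<open>N\<close> cancels from the
  result.\<close>

lemma card_edges_structured_le:
  fixes A B :: "nat set" and N :: nat and X Y D :: real
  assumes fin: "finite A" "finite B" and E: "E \<subseteq> A \<times> B"
    and A: "\<And>a. a \<in> A \<Longrightarrow> 0 < a \<and> real a \<le> X" and B: "\<And>b. b \<in> B \<Longrightarrow> 0 < b \<and> real b \<le> Y"
    and XYD: "0 \<le> X" "0 \<le> Y" "0 < D" and N: "0 < N"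
    and D: "\<And>a b. (a, b) \<in> E \<Longrightarrow> D \<le> gcd a b"
    and mult: "\<And>a b p. (a, b) \<in> E \<Longrightarrow> prime p \<Longrightarrow>
      multiplicity p a = multiplicity p N \<or> multiplicity p b = multiplicity p N"
  shows "real (card E) \<le> 2 * sqrt (X * Y / D\<^sup>2 * (card A * card B))"
proof -
  have pos: "0 < N div gcd N a" for a
    using N by (simp add: div_greater_zero_iff gcd_le1_nat)
  have "real (card E) \<le> 2 * sqrt (X / N * (Y / N) * (N / D)\<^sup>2 * (card A * card B))"
  proof (rule card_pairs_le_if_rank_le[OF fin E])
    fix a b assume ab: "(a, b) \<in> E"
    then have "gcd a b * (N div gcd N a) * (N div gcd N b) \<le> N"
      using A B E N mult by (intro dvd_imp_le gcd_mult_cofactors_dvd) auto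
    then have "real (gcd a b) * (real (N div gcd N a) * real (N div gcd N b)) \<le> real N"
      by (metis of_nat_le_iff of_nat_mult mult.assoc)
    moreover have "D * (real (N div gcd N a) * real (N div gcd N b))
        \<le> real (gcd a b) * (real (N div gcd N a) * real (N div gcd N b))"
      using D[OF ab] by (intro mult_right_mono) auto
    ultimately show "real (N div gcd N a) * real (N div gcd N b) \<le> N / D"
      using XYD by (simp add: field_simps)
  qed (use XYD N A B fin pos card_div_gcd_le in auto)
  also have "X / N * (Y / N) * (N / D)\<^sup>2 = X * Y / D\<^sup>2"
    using N by (simp add: field_simps power2_eq_square)
  finally show ?thesis .
qed

subsection \<open>Concentration of valuations\<close>

text \<open>By Schur's test the terms with \<open>i \<noteq> j\<close> contribute at most
  \<open>4 * t\<close>, so the diagonal carries at least \<open>1 - 4 * t\<close>. With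
  \<open>k\<close> maximising \<open>\<alpha> k * \<beta> k\<close>, each diagonal term is at most
  \<open>(\<alpha> k * \<beta> k) powr (r - 1/2)\<close> times the mean of \<open>\<alpha> i\<close>
  and \<open>\<beta> i\<close>, and these means sum to 1.\<close>

lemma exists_concentrated_index:
  fixes t r :: real and I :: "nat set"
  assumes I: "finite I" and r: "1/2 \<le> r" and t: "0 \<le> t" "t \<le> 1/2"
    and \<alpha>: "\<And>i. i \<in> I \<Longrightarrow> 0 \<le> \<alpha> i" "sum \<alpha> I = 1"
    and \<beta>: "\<And>i. i \<in> I \<Longrightarrow> 0 \<le> \<beta> i" "sum \<beta> I = 1"
    and ge: "1 \<le> (\<Sum>i\<in>I. \<Sum>j\<in>I. t^(i-j) * t^(j-i) * (\<alpha> i * \<beta> j) powr r)"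
  shows "\<exists>k\<in>I. 1 - 4 * t \<le> (\<alpha> k * \<beta> k) powr (r - 1/2)"
proof -
  define M :: "nat \<Rightarrow> nat \<Rightarrow> real" where "M i j = (if i = j then 0 else t^(i-j) * t^(j-i))" for i j
  have M0: "0 \<le> M i j" for i j using t by (simp add: M_def)
  have row: "(\<Sum>j\<in>I. M i j) \<le> 4 * t" for i
  proof -
    have "(\<Sum>j\<in>I. M i j) = (\<Sum>j\<in>I-{i}. t^(i-j) * t^(j-i))"
      using I by (intro sum.mono_neutral_cong_right) (auto simp: M_def)
    also have "\<dots> \<le> 2 * t / (1 - t)" using I t by (intro sum_power_abs_diff_le) auto
    also have "\<dots> \<le> 4 * t"
      using t mult_left_mono[of t "1/2" t] by (simp add: field_simps)
    finally show ?thesis .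
  qed
  have sym: "M i j = M j i" for i j by (simp add: M_def mult.commute)
  have off: "(\<Sum>i\<in>I. \<Sum>j\<in>I. M i j * (\<alpha> i * \<beta> j) powr r) \<le> 4 * t"
  proof -
    have "(\<Sum>i\<in>I. M i j) \<le> 4 * t" for j
      using row[of j] by (simp add: sym[of _ j])
    then have "(\<Sum>i\<in>I. \<Sum>j\<in>I. M i j * (\<alpha> i * \<beta> j) powr r) \<le> 4 * t * (sum \<alpha> I * sum \<beta> I) powr r"
      using I r \<alpha>(1) \<beta>(1) M0 row by (intro schur_test_powr) auto
    then show ?thesis using \<alpha>(2) \<beta>(2) by simp
  qed
  have "I \<noteq> {}" using \<alpha>(2) by auto
  then obtain k where k: "k \<in> I" "\<And>i. i \<in> I \<Longrightarrow> \<alpha> i * \<beta> i \<le> \<alpha> k * \<beta> k"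
    using Max_in[of "(\<lambda>i. \<alpha> i * \<beta> i) ` I"] Max_ge[of "(\<lambda>i. \<alpha> i * \<beta> i) ` I"] I
    by (smt (verit) finite_imageI imageE imageI image_is_empty)
  have "(\<Sum>i\<in>I. \<Sum>j\<in>I. t^(i-j) * t^(j-i) * (\<alpha> i * \<beta> j) powr r)
      = (\<Sum>i\<in>I. \<Sum>j\<in>I. M i j * (\<alpha> i * \<beta> j) powr r + (if i = j then (\<alpha> i * \<beta> i) powr r else 0))"
    by (intro sum.cong refl) (auto simp: M_def)
  also have "\<dots> = (\<Sum>i\<in>I. \<Sum>j\<in>I. M i j * (\<alpha> i * \<beta> j) powr r) + (\<Sum>i\<in>I. (\<alpha> i * \<beta> i) powr r)"
    using I by (simp add: sum.distrib)
  also have "(\<Sum>i\<in>I. (\<alpha> i * \<beta> i) powr r) \<le> (\<Sum>i\<in>I. (\<alpha> k * \<beta> k) powr (r - 1/2) * ((\<alpha> i + \<beta> i) / 2))"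
  proof (rule sum_mono)
    fix i assume i: "i \<in> I"
    have nn: "0 \<le> \<alpha> i" "0 \<le> \<beta> i" using i \<alpha> \<beta> by auto
    have "(\<alpha> i * \<beta> i) powr r = (\<alpha> i * \<beta> i) powr (r - 1/2) * (\<alpha> i * \<beta> i) powr (1/2)"
      by (simp flip: powr_add)
    also have "\<dots> \<le> (\<alpha> k * \<beta> k) powr (r - 1/2) * ((\<alpha> i + \<beta> i) / 2)"
      using k(2)[OF i] nn r arith_geo_mean_sqrt[of "\<alpha> i" "\<beta> i"]
      by (intro mult_mono[OF powr_mono2]) (auto simp: powr_half_sqrt)
    finally show "(\<alpha> i * \<beta> i) powr r \<le> (\<alpha> k * \<beta> k) powr (r - 1/2) * ((\<alpha> i + \<beta> i) / 2)" .
  qed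
  also have "(\<Sum>i\<in>I. (\<alpha> k * \<beta> k) powr (r - 1/2) * ((\<alpha> i + \<beta> i) / 2)) = (\<alpha> k * \<beta> k) powr (r - 1/2)"
    using \<alpha>(2) \<beta>(2) by (simp add: sum.distrib flip: sum_distrib_left sum_divide_distrib)
  finally show ?thesis using ge off k(1) by force
qed

text \<open>A bootstrap: \<open>x\<close> and \<open>y\<close> stand for the masses away from the
  concentrated index, known only to be below \<open>\<eta>\<close>, and \<open>c\<close> for
  \<open>4 / p\<close>. For the larger one, \<open>z\<close>, the condition on \<open>\<eta>\<close>
  makes the product term at most \<open>z / 4\<close>, which the left side absorbs. What remains is
  \<open>z powr s \<le> 8 * c powr s\<close>, so \<open>z\<close> is in fact of order
  \<open>c\<close>.\<close>

lemma powr_self_bound: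
  fixes s c x y \<eta> :: real
  assumes s: "0 < s" "s < 1/2" and c: "0 < c"
    and x: "0 \<le> x" "x \<le> \<eta>" and y: "0 \<le> y" "y \<le> \<eta>" and \<eta>: "12 * \<eta> powr (1 - 2 * s) \<le> 1"
    and le: "(x + y) / 2 \<le> c powr s * (x powr (1 - s) + y powr (1 - s)) + 3 * (x * y) powr (1 - s)"
  shows "(x * y) powr (1 - s) \<le> (8 powr (1 / s) * c) powr (2 * (1 - s))"
proof -
  define z where "z = max x y"
  have z: "0 \<le> z" "z \<le> \<eta>" "x \<le> z" "y \<le> z" using x y by (auto simp: z_def)
  have "x * y \<le> z * z" using x y z by (intro mult_mono) auto
  then have "(x * y) powr (1 - s) \<le> (z * z) powr (1 - s)"
    using s x y by (intro powr_mono2) auto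
  also have zz: "(z * z) powr (1 - s) = z powr (2 * (1 - s))"
    using z by (simp add: powr_mult flip: powr_add)
  finally have xy: "(x * y) powr (1 - s) \<le> z powr (2 * (1 - s))" .
  have "z \<le> 8 powr (1 / s) * c"
  proof (cases "z = 0")
    case True
    then show ?thesis using c by simp
  next
    case False
    then have z0: "z > 0" using z by simp
    have "z powr (2 * (1 - s)) = z powr (1 - 2 * s) * z"
      using z0 using powr_add[of z "1 - 2 * s" 1] by (simp add: algebra_simps)
    also have "\<dots> \<le> \<eta> powr (1 - 2 * s) * z"
      using z s by (intro mult_right_mono powr_mono2) auto
    also have "\<dots> \<le> 1 / 12 * z" using \<eta> z by (intro mult_right_mono) auto
    finally have A: "3 * z powr (2 * (1 - s)) \<le> z / 4" by simp
    have B: "c powr s * (x powr (1 - s) + y powr (1 - s)) \<le> c powr s * (2 * z powr (1 - s))"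
      using powr_mono2[of "1 - s" x z] powr_mono2[of "1 - s" y z] s x y z
      by (intro mult_left_mono) auto
    have "z \<le> x + y" using x y by (auto simp: z_def)
    then have "z / 2 \<le> (x + y) / 2" by simp
    also note le
    also have "c powr s * (x powr (1 - s) + y powr (1 - s)) + 3 * (x * y) powr (1 - s)
        \<le> c powr s * (2 * z powr (1 - s)) + z / 4"
      using A B xy by (intro add_mono) auto
    finally have "z / 4 \<le> c powr s * (2 * z powr (1 - s))" by (simp add: field_simps)
    moreover have "z = z powr s * z powr (1 - s)" using z0 by (simp flip: powr_add)
    ultimately have "z powr s * z powr (1 - s) \<le> (8 * c powr s) * z powr (1 - s)" by simp
    then have "z powr s \<le> 8 * c powr s" using z0 by simp
    then have "(z powr s) powr (1 / s) \<le> (8 * c powr s) powr (1 / s)"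
      using s by (intro powr_mono2) auto
    then show ?thesis using s z0 c by (simp add: powr_mult powr_powr)
  qed
  then have "z powr (2 * (1 - s)) \<le> (8 powr (1 / s) * c) powr (2 * (1 - s))"
    using z s by (intro powr_mono2) auto
  with xy show ?thesis by linarith
qed

text \<open>For use with \<open>p\<close> prime, \<open>\<alpha>\<close> and \<open>\<beta>\<close>
  the densities of the valuation fibres and \<open>e\<close> the share of edges in each pair of
  fibres. The exponent \<open>-2 * (1 - s)\<close> is below -1, so the bound can be summed over
  primes.\<close>

lemma off_concentration_bound:
  fixes s :: real
  assumes s: "0 < s" "s < 1/2"
  obtains P0 C :: real where
    "\<And>p (I :: nat set) \<alpha> \<beta> e. P0 \<le> p \<Longrightarrow> finite I \<Longrightarrow>
      (\<And>i. i \<in> I \<Longrightarrow> 0 \<le> \<alpha> i) \<Longrightarrow> sum \<alpha> I = 1 \<Longrightarrow> (\<And>i. i \<in> I \<Longrightarrow> 0 \<le> \<beta> i) \<Longrightarrow> sum \<beta> I = 1 \<Longrightarrow>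
      (\<And>i j. i \<in> I \<Longrightarrow> j \<in> I \<Longrightarrow>
        e i j \<le> (p powr -s)^(i-j) * (p powr -s)^(j-i) * (\<alpha> i * \<beta> j) powr (1 - s)) \<Longrightarrow>
      (\<Sum>i\<in>I. \<Sum>j\<in>I. e i j) = 1 \<Longrightarrow>
      \<exists>k\<in>I. (\<Sum>i\<in>I-{k}. \<Sum>j\<in>I-{k}. e i j) \<le> C * p powr (-2 * (1 - s))"
proof -
  define r where "r = 1 - s"
  \<comment> \<open>Solves \<open>12 * \<eta> powr (1 - 2 * s) = 1\<close>, the smallness needed for
    \<open>powr_self_bound\<close>.\<close>
  define \<eta> where "\<eta> = (1/12 :: real) powr (1 / (1 - 2 * s))"
  have \<eta>: "0 < \<eta>" "\<eta> < 1" "12 * \<eta> powr (1 - 2 * s) \<le> 1"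
    using s using powr_less_mono2[of "1 / (1 - 2 * s)" "1/12" 1] by (auto simp: \<eta>_def powr_powr)
  \<comment> \<open>For \<open>t \<le> t0\<close> the concentration bound \<open>1 - 4 * t\<close>
    is at least \<open>(1 - \<eta>) powr (r - 1/2)\<close>, which forces
    \<open>\<alpha> k * \<beta> k \<ge> 1 - \<eta>\<close>. The cap 1/2 keeps
    \<open>(1 + t) / (1 - t)\<close> at most 3. \<open>P0\<close> then ensures
    \<open>p powr -s \<le> t0\<close>.\<close>
  define t0 where "t0 = min (1/2) ((1 - (1 - \<eta>) powr (r - 1/2)) / 4)"
  have "(1 - \<eta>) powr (r - 1/2) < 1"
    using \<eta> s powr_less_mono2[of "r - 1/2" "1 - \<eta>" 1] by (auto simp: r_def)
  then have t0: "0 < t0" "t0 \<le> 1/2" "(1 - \<eta>) powr (r - 1/2) \<le> 1 - 4 * t0"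
    unfolding t0_def by (auto simp: min_def field_simps)
  define P0 where "P0 = max 2 (t0 powr (- 1 / s))"
  define C where "C = 3 * (8 powr (1 / s) * 4) powr (2 * (1 - s))"
  show thesis
  proof
    fix p :: real and I :: "nat set" and \<alpha> \<beta> :: "nat \<Rightarrow> real" and e
    assume p: "P0 \<le> p" and I: "finite I"
      and \<alpha>: "\<And>i. i \<in> I \<Longrightarrow> 0 \<le> \<alpha> i" "sum \<alpha> I = 1"
      and \<beta>: "\<And>i. i \<in> I \<Longrightarrow> 0 \<le> \<beta> i" "sum \<beta> I = 1"
      and e: "\<And>i j. i \<in> I \<Longrightarrow> j \<in> I \<Longrightarrow>
        e i j \<le> (p powr -s)^(i-j) * (p powr -s)^(j-i) * (\<alpha> i * \<beta> j) powr (1 - s)"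
      and sum_e: "(\<Sum>i\<in>I. \<Sum>j\<in>I. e i j) = 1"
    define t where "t = p powr -s"
    have p2: "p \<ge> 2" using p by (simp add: P0_def)
    have "t \<le> (t0 powr (- 1 / s)) powr -s"
      unfolding t_def using p s t0 by (intro powr_mono2') (auto simp: P0_def)
    then have tt: "t \<le> t0" using s t0 by (simp add: powr_powr)
    have t: "0 \<le> t" "t \<le> 1/2" using tt t0 by (auto simp: t_def)
    have r: "1/2 \<le> r" "1/2 < r" "r < 1" using s by (auto simp: r_def)
    have e': "e i j \<le> t^(i-j) * t^(j-i) * (\<alpha> i * \<beta> j) powr r" if "i \<in> I" "j \<in> I" for i j
      using e[OF that] by (simp add: t_def r_def)
    have "1 \<le> (\<Sum>i\<in>I. \<Sum>j\<in>I. t^(i-j) * t^(j-i) * (\<alpha> i * \<beta> j) powr r)"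
      unfolding sum_e[symmetric] using e' by (intro sum_mono) auto
    from exists_concentrated_index[OF I r(1) t \<alpha> \<beta> this]
    obtain k where k: "k \<in> I" "1 - 4 * t \<le> (\<alpha> k * \<beta> k) powr (r - 1/2)" by auto
    define x y where "x = sum \<alpha> (I - {k})" and "y = sum \<beta> (I - {k})"
    have xk: "\<alpha> k = 1 - x" and yk: "\<beta> k = 1 - y"
      using k I \<alpha>(2) \<beta>(2) by (auto simp: x_def y_def sum.remove[OF I k(1)])
    have x0: "0 \<le> x" "x \<le> 1" and y0: "0 \<le> y" "y \<le> 1"
      using \<alpha>(1) \<beta>(1) k(1) xk yk by (auto simp: x_def y_def intro!: sum_nonneg) (smt (verit))+
    have "(1 - \<eta>) powr (r - 1/2) \<le> (\<alpha> k * \<beta> k) powr (r - 1/2)"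
      using k(2) t0 tt by linarith
    then have "1 - \<eta> \<le> \<alpha> k * \<beta> k"
      using r x0 y0 xk yk \<eta> powr_less_mono2[of "r - 1/2" "\<alpha> k * \<beta> k" "1 - \<eta>"] by force
    moreover have "\<alpha> k * \<beta> k \<le> \<alpha> k" "\<alpha> k * \<beta> k \<le> \<beta> k"
      using x0 y0 by (auto simp: xk yk mult_left_le mult_left_le_one_le)
    ultimately have x\<eta>: "x \<le> \<eta>" and y\<eta>: "y \<le> \<eta>" by (auto simp: xk yk)
    define h where "h i j = t^(i-j) * t^(j-i) * (\<alpha> i * \<beta> j) powr r" for i j
    \<comment> \<open>Writing the kernel as an \<open>s\<close>-th power puts the row and column
      sums into the form of Hoelder's inequality; the weights off \<open>k\<close> then add up to at
      most \<open>4 / p\<close>.\<close>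
    have sw: "t^(k-j) * t^(j-k) = ((1/p)^(k-j) * (1/p)^(j-k)) powr s" for j
    proof -
      have "t ^ n = ((1/p) ^ n) powr s" for n
        using p2 unfolding t_def
        by (simp add: powr_minus powr_divide powr_realpow[symmetric] powr_powr power_one_over inverse_eq_divide)
           (simp add: powr_powr mult.commute flip: powr_realpow)
      then show ?thesis using p2 by (simp add: powr_mult)
    qed
    have w: "(\<Sum>j\<in>I-{k}. (1/p)^(k-j) * (1/p)^(j-k)) powr s \<le> (4/p) powr s"
    proof -
      have "(\<Sum>j\<in>I-{k}. (1/p)^(k-j) * (1/p)^(j-k)) \<le> 2 * (1/p) / (1 - 1/p)"
        using I p2 by (intro sum_power_abs_diff_le) auto
      also have "\<dots> \<le> 4 / p" using p2 by (simp add: field_simps)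
      finally show ?thesis using s p2 by (intro powr_mono2) (auto intro!: sum_nonneg)
    qed
    have cross: "(\<Sum>j\<in>I-{k}. t^(k-j) * t^(j-k) * (c * \<gamma> j) powr r) \<le> (4/p) powr s * sum \<gamma> (I-{k}) powr r"
      if c: "0 \<le> c" "c \<le> 1" and \<gamma>: "\<And>j. j \<in> I \<Longrightarrow> 0 \<le> \<gamma> j" for c and \<gamma> :: "nat \<Rightarrow> real"
    proof -
      have "(\<Sum>j\<in>I-{k}. t^(k-j) * t^(j-k) * (c * \<gamma> j) powr r)
          \<le> (\<Sum>j\<in>I-{k}. ((1/p)^(k-j) * (1/p)^(j-k)) powr s * \<gamma> j powr r)"
        unfolding sw using c \<gamma> r
        by (intro sum_mono mult_left_mono powr_mono2) (auto simp: mult_left_le_one_le)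
      also have "\<dots> \<le> (\<Sum>j\<in>I-{k}. (1/p)^(k-j) * (1/p)^(j-k)) powr s * sum \<gamma> (I-{k}) powr r"
        unfolding r_def using I s p2 \<gamma> by (intro sum_powr_mult_powr_le) auto
      also have "\<dots> \<le> (4/p) powr s * sum \<gamma> (I-{k}) powr r"
        using w by (intro mult_right_mono) auto
      finally show ?thesis .
    qed
    have row: "(\<Sum>j\<in>I-{k}. e k j) \<le> (4/p) powr s * y powr r"
    proof -
      have "(\<Sum>j\<in>I-{k}. e k j) \<le> (\<Sum>j\<in>I-{k}. t^(k-j) * t^(j-k) * (\<alpha> k * \<beta> j) powr r)"
        using e' k by (intro sum_mono) auto
      also have "\<dots> \<le> (4/p) powr s * y powr r"
        unfolding y_def using \<beta> x0 by (intro cross) (auto simp: xk)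
      finally show ?thesis .
    qed
    have col: "(\<Sum>i\<in>I-{k}. e i k) \<le> (4/p) powr s * x powr r"
    proof -
      have "(\<Sum>i\<in>I-{k}. e i k) \<le> (\<Sum>i\<in>I-{k}. t^(k-i) * t^(i-k) * (\<beta> k * \<alpha> i) powr r)"
        using e' k by (intro sum_mono) (auto simp: mult.commute)
      also have "\<dots> \<le> (4/p) powr s * x powr r"
        unfolding x_def using \<alpha> y0 by (intro cross) (auto simp: yk)
      finally show ?thesis .
    qed
    \<comment> \<open>The arithmetic-geometric mean makes the loss on the diagonal linear in
      \<open>x\<close> and \<open>y\<close>; this linear term becomes the left side of the
      bootstrap.\<close>
    have diag: "e k k \<le> 1 - (x + y) / 2"
    proof -
      have "e k k \<le> (\<alpha> k * \<beta> k) powr r" using e'[OF k(1) k(1)] by simp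
      also have "\<dots> \<le> (\<alpha> k * \<beta> k) powr (1/2)"
        using r x0 y0 by (intro powr_mono') (auto simp: xk yk mult_le_one)
      also have "\<dots> \<le> (\<alpha> k + \<beta> k) / 2"
        using arith_geo_mean_sqrt[of "\<alpha> k" "\<beta> k"] x0 y0 by (simp add: powr_half_sqrt xk yk)
      finally show ?thesis by (simp add: xk yk field_simps)
    qed
    have off: "(\<Sum>i\<in>I-{k}. \<Sum>j\<in>I-{k}. e i j) \<le> 3 * (x * y) powr r"
    proof -
      have "(\<Sum>i\<in>I-{k}. \<Sum>j\<in>I-{k}. e i j)
          \<le> (\<Sum>i\<in>I-{k}. \<Sum>j\<in>I-{k}. t^(i-j) * t^(j-i) * (\<alpha> i * \<beta> j) powr r)"
        using e' by (intro sum_mono) auto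
      also have "\<dots> \<le> (1 + t) / (1 - t) * (x * y) powr r"
        unfolding x_def y_def
      proof (rule schur_test_powr)
        fix j
        show "(\<Sum>i\<in>I-{k}. t^(i-j) * t^(j-i)) \<le> (1 + t) / (1 - t)"
          using sum_power_abs_diff_le(1)[of "I-{k}" t j] I t by (simp add: mult.commute)
      qed (use I r t \<alpha> \<beta> in \<open>auto intro!: sum_power_abs_diff_le\<close>)
      also have "\<dots> \<le> 3 * (x * y) powr r"
        using t by (intro mult_right_mono) (auto simp: field_simps)
      finally show ?thesis .
    qed
    \<comment> \<open>Splitting the total mass into the entry at \<open>k\<close>, the rest of its
      row, the rest of its column and the remaining block; the two 1s cancel after inserting the
      four bounds.\<close>
    have "1 = e k k + (\<Sum>j\<in>I-{k}. e k j) + ((\<Sum>i\<in>I-{k}. e i k) + (\<Sum>i\<in>I-{k}. \<Sum>j\<in>I-{k}. e i j))"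
      unfolding sum_e[symmetric] sum.remove[OF I k(1)] by (simp add: sum.distrib)
    also have "\<dots> \<le> (1 - (x + y) / 2) + (4/p) powr s * y powr r + ((4/p) powr s * x powr r + 3 * (x * y) powr r)"
      using row col diag off by (intro add_mono)
    finally have "(x + y) / 2 \<le> (4/p) powr s * (x powr r + y powr r) + 3 * (x * y) powr r"
      by (simp add: algebra_simps)
    then have "(x * y) powr r \<le> (8 powr (1 / s) * (4 / p)) powr (2 * (1 - s))"
      unfolding r_def using s p2 x0 y0 x\<eta> y\<eta> \<eta> by (intro powr_self_bound) auto
    also have "\<dots> = (8 powr (1 / s) * 4) powr (2 * (1 - s)) * p powr (-2 * (1 - s))"
      using p2 by (simp add: powr_mult powr_divide powr_minus field_simps flip: powr_add)
    finally show "\<exists>k\<in>I. (\<Sum>i\<in>I-{k}. \<Sum>j\<in>I-{k}. e i j) \<le> C * p powr (-2 * (1 - s))"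
      using off k(1) by (intro bexI[of _ k]) (auto simp: C_def)
  qed
qed

subsection \<open>Fibres over the valuations at a prime\<close>

text \<open>Dividing out the power of \<open>p\<close>, rather than only restricting to a fibre,
  removes \<open>p\<close> from the prime divisors and so lets the induction proceed.\<close>

definition strip :: "nat \<Rightarrow> nat \<Rightarrow> nat set \<Rightarrow> nat set" where
  "strip p i A = {m. \<not> p dvd m \<and> p ^ i * m \<in> A}"

text \<open>With \<open>s = 1 / (2 + \<epsilon>)\<close> this says \<open>|E|\<^bsup>2+\<epsilon>\<^esup> \<le> C (X Y / D\<^sup>2) (|A| |B|)\<^bsup>1+\<epsilon>\<^esup>\<close>.\<close>

definition gcd_bound :: "real \<Rightarrow> real \<Rightarrow> nat set \<Rightarrow> nat set \<Rightarrow> bool" where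
  "gcd_bound s C A B \<longleftrightarrow> (\<forall>E X Y D. E \<subseteq> A \<times> B \<longrightarrow> 0 < X \<longrightarrow> 0 < Y \<longrightarrow> 0 < D \<longrightarrow>
     (\<forall>a\<in>A. real a \<le> X) \<longrightarrow> (\<forall>b\<in>B. real b \<le> Y) \<longrightarrow> (\<forall>(a, b)\<in>E. D \<le> real (gcd a b)) \<longrightarrow>
     real (card E) \<le> (C * (X * Y / D\<^sup>2)) powr s * (real (card A) * real (card B)) powr (1 - s))"

lemma gcd_boundD:
  assumes "gcd_bound s C A B" "E \<subseteq> A \<times> B" "0 < X" "0 < Y" "0 < D"
    "\<forall>a\<in>A. real a \<le> X" "\<forall>b\<in>B. real b \<le> Y" "\<forall>(a, b)\<in>E. D \<le> real (gcd a b)"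
  shows "real (card E) \<le> (C * (X * Y / D\<^sup>2)) powr s * (real (card A) * real (card B)) powr (1 - s)"
  using assms unfolding gcd_bound_def by blast

lemma gcd_bound_mono:
  assumes "gcd_bound s C A B" "0 \<le> C" "C \<le> C'" "0 \<le> s"
  shows "gcd_bound s C' A B"
  unfolding gcd_bound_def
proof (intro allI impI)
  fix E X Y D
  assume *: "E \<subseteq> A \<times> B" "0 < (X::real)" "0 < (Y::real)" "0 < (D::real)"
    "\<forall>a\<in>A. real a \<le> X" "\<forall>b\<in>B. real b \<le> Y" "\<forall>(a, b)\<in>E. D \<le> real (gcd a b)"
  then have "real (card E) \<le> (C * (X * Y / D\<^sup>2)) powr s * (real (card A) * real (card B)) powr (1 - s)"
    by (rule gcd_boundD[OF assms(1)])
  also have "\<dots> \<le> (C' * (X * Y / D\<^sup>2)) powr s * (real (card A) * real (card B)) powr (1 - s)"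
    using assms * by (intro mult_right_mono powr_mono2) auto
  finally show "real (card E) \<le> (C' * (X * Y / D\<^sup>2)) powr s * (real (card A) * real (card B)) powr (1 - s)" .
qed

lemma multiplicity_eq_iff_exists_cofactor:
  fixes p :: nat
  assumes "prime p" "0 < a"
  shows "multiplicity p a = i \<longleftrightarrow> (\<exists>m. \<not> p dvd m \<and> a = p ^ i * m)"
proof
  assume "multiplicity p a = i"
  then show "\<exists>m. \<not> p dvd m \<and> a = p ^ i * m"
    using multiplicity_decompose'[of a p] assms by (metis neq0_conv not_prime_unit)
next
  assume "\<exists>m. \<not> p dvd m \<and> a = p ^ i * m"
  then obtain m where m: "\<not> p dvd m" "a = p ^ i * m" by auto
  show "multiplicity p a = i"
    using m assms by (intro multiplicity_eqI) (auto simp: prime_gt_0_nat)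
qed

lemma card_strip:
  assumes "prime p" "0 \<notin> A"
  shows "card (strip p i A) = card {a\<in>A. multiplicity p a = i}"
proof -
  have "{a\<in>A. multiplicity p a = i} = (\<lambda>m. p ^ i * m) ` strip p i A"
    using assms multiplicity_eq_iff_exists_cofactor[OF assms(1)]
    by (auto simp: strip_def image_iff) (metis neq0_conv)+
  moreover have "inj_on (\<lambda>m. p ^ i * m) (strip p i A)"
    using assms by (auto simp: inj_on_def)
  ultimately show ?thesis by (simp add: card_image)
qed

lemma gcd_prime_power_mult:
  fixes p m n :: nat
  assumes "prime p" "\<not> p dvd m" "\<not> p dvd n"
  shows "gcd (p ^ i * m) (p ^ j * n) = p ^ min i j * gcd m n"
proof -
  have cop: "coprime p m" "coprime p n"
    using assms by (simp_all add: prime_imp_coprime)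
  have le: "gcd (p ^ i * m) (p ^ j * n) = p ^ i * gcd m n"
    if "i \<le> j" "coprime p m" for i j m n
  proof -
    have "gcd (p ^ i * m) (p ^ j * n) = gcd (p ^ i * m) (p ^ i * (p ^ (j - i) * n))"
      using that by (simp flip: power_add mult.assoc)
    also have "\<dots> = p ^ i * gcd m (p ^ (j - i) * n)" by (simp add: gcd_mult_distrib_nat)
    also have "gcd m (p ^ (j - i) * n) = gcd m n"
      using that(2) by (intro gcd_mult_right_left_cancel) (simp add: coprime_commute)
    finally show ?thesis .
  qed
  show ?thesis
    using le[of i j m n] le[of j i n m] cop by (cases "i \<le> j") (auto simp: min_def gcd.commute)
qed

text \<open>Dividing out \<open>p\<close> rescales \<open>X\<close>, \<open>Y\<close>,
  \<open>D\<close> by \<open>p ^ i\<close>, \<open>p ^ j\<close>, \<open>p ^ min i j\<close>. Thus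
  \<open>X * Y / D\<^sup>2\<close> loses a factor p to the power i + j - 2 min(i, j) = |i - j|. This
  rescaling is why \<open>gcd_bound\<close> quantifies over all positive real \<open>X\<close>,
  \<open>Y\<close>, \<open>D\<close>.\<close>

lemma card_fibre_le:
  fixes p i j :: nat
  assumes bd: "gcd_bound s C (strip p i A) (strip p j B)" and p: "prime p"
    and 0: "0 \<notin> A" "0 \<notin> B" and E: "E \<subseteq> A \<times> B" and pos: "0 < X" "0 < Y" "0 < D" "0 \<le> C"
    and X: "\<forall>a\<in>A. real a \<le> X" and Y: "\<forall>b\<in>B. real b \<le> Y" and D: "\<forall>(a, b)\<in>E. D \<le> real (gcd a b)"
  shows "real (card {(a, b)\<in>E. multiplicity p a = i \<and> multiplicity p b = j})
    \<le> (C * (X * Y / D\<^sup>2)) powr s * ((p powr -s)^(i-j) * (p powr -s)^(j-i) *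
      (real (card {a\<in>A. multiplicity p a = i}) * real (card {b\<in>B. multiplicity p b = j})) powr (1 - s))"
proof -
  define E' where "E' = {(m, n). \<not> p dvd m \<and> \<not> p dvd n \<and> (p ^ i * m, p ^ j * n) \<in> E}"
  define h where "h = (\<lambda>(m, n). (p ^ i * m, p ^ j * n))"
  have p0: "p > 0" using p by (simp add: prime_gt_0_nat)
  have "{(a, b)\<in>E. multiplicity p a = i \<and> multiplicity p b = j} = h ` E'"
  proof (intro equalityI subsetI)
    fix x assume "x \<in> {(a, b)\<in>E. multiplicity p a = i \<and> multiplicity p b = j}"
    then obtain a b where x: "x = (a, b)" "(a, b) \<in> E" "multiplicity p a = i" "multiplicity p b = j" by auto
    then have "0 < a" "0 < b" using E 0 by (metis SigmaE2 neq0_conv subsetD)+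
    with x p obtain m n where "\<not> p dvd m" "a = p ^ i * m" "\<not> p dvd n" "b = p ^ j * n"
      by (metis multiplicity_eq_iff_exists_cofactor)
    then show "x \<in> h ` E'" using x by (auto simp: h_def E'_def)
  next
    fix x assume "x \<in> h ` E'"
    then obtain m n where mn: "\<not> p dvd m" "\<not> p dvd n" "x = (p ^ i * m, p ^ j * n)" "x \<in> E"
      by (auto simp: h_def E'_def)
    then have "0 < p ^ i * m" "0 < p ^ j * n" using E 0 by (metis SigmaE2 neq0_conv subsetD)+
    then show "x \<in> {(a, b)\<in>E. multiplicity p a = i \<and> multiplicity p b = j}"
      using mn p multiplicity_eq_iff_exists_cofactor by auto
  qed
  moreover have "inj_on h E'" using p0 by (auto simp: inj_on_def h_def)
  ultimately have "card {(a, b)\<in>E. multiplicity p a = i \<and> multiplicity p b = j} = card E'"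
    by (simp add: card_image)
  also have "real (card E') \<le> (C * (X / p ^ i * (Y / p ^ j) / (D / p ^ min i j)\<^sup>2)) powr s
      * (real (card (strip p i A)) * real (card (strip p j B))) powr (1 - s)"
  proof -
    have "E' \<subseteq> strip p i A \<times> strip p j B" using E by (auto simp: E'_def strip_def)
    moreover have "\<forall>a\<in>strip p i A. real a \<le> X / p ^ i"
      using X p0 by (auto simp: strip_def field_simps dest!: bspec)
    moreover have "\<forall>b\<in>strip p j B. real b \<le> Y / p ^ j"
      using Y p0 by (auto simp: strip_def field_simps dest!: bspec)
    moreover have "\<forall>(m, n)\<in>E'. D / p ^ min i j \<le> real (gcd m n)"
    proof (intro ballI, clarify)
      fix m n assume mn: "(m, n) \<in> E'"
      then have "D \<le> real (gcd (p ^ i * m) (p ^ j * n))" using D by (auto simp: E'_def)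
      also have "gcd (p ^ i * m) (p ^ j * n) = p ^ min i j * gcd m n"
        using mn p by (intro gcd_prime_power_mult) (auto simp: E'_def)
      finally show "D / p ^ min i j \<le> real (gcd m n)" using p0 by (simp add: field_simps)
    qed
    ultimately show ?thesis
      using pos p0 by (intro gcd_boundD[OF bd]) auto
  qed
  also have "(C * (X / p ^ i * (Y / p ^ j) / (D / p ^ min i j)\<^sup>2)) powr s
      = (C * (X * Y / D\<^sup>2)) powr s * ((p powr -s)^(i-j) * (p powr -s)^(j-i))"
  proof -
    have pw: "(real p powr -s) ^ n = (1 / real p ^ n) powr s" for n
      using p0 by (simp add: powr_divide powr_minus powr_powr power_inverse inverse_eq_divide flip: powr_realpow)
        (simp add: powr_powr mult.commute power_one_over flip: powr_realpow)
    have "i + j = min i j + min i j + ((i - j) + (j - i))" by auto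
    then have "real p ^ i * real p ^ j = (real p ^ min i j)\<^sup>2 * (real p ^ (i - j) * real p ^ (j - i))"
      by (metis power_add power2_eq_square)
    then have "C * (X / p ^ i * (Y / p ^ j) / (D / p ^ min i j)\<^sup>2)
       = C * (X * Y / D\<^sup>2) * (1 / real p ^ (i - j) * (1 / real p ^ (j - i)))"
      using p0 pos by (simp add: field_simps)
    then show ?thesis
      unfolding pw using pos p0 by (simp only: powr_mult)
  qed
  finally show ?thesis
    using p 0 by (simp add: card_strip mult_ac)
qed

lemma card_fibres:
  assumes "finite E" "finite I" "\<And>a b. (a, b) \<in> E \<Longrightarrow> f a \<in> I \<and> g b \<in> J" "finite J"
  shows "(\<Sum>i\<in>I. \<Sum>j\<in>J. card {(a, b)\<in>E. f a = i \<and> g b = j}) = card E"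
proof -
  have "(\<Sum>i\<in>I. \<Sum>j\<in>J. card {(a, b)\<in>E. f a = i \<and> g b = j})
     = (\<Sum>y\<in>I \<times> J. card {x\<in>E. map_prod f g x = y})"
  proof -
    have "{(a, b)\<in>E. f a = i \<and> g b = j} = {x\<in>E. map_prod f g x = (i, j)}" for i j by auto
    then show ?thesis by (simp add: sum.cartesian_product case_prod_beta)
  qed
  also have "\<dots> = (\<Sum>y\<in>I \<times> J. \<Sum>x\<in>{x\<in>E. map_prod f g x = y}. 1)" by simp
  also have "\<dots> = (\<Sum>x\<in>E. 1)"
    using assms by (intro sum.group) auto
  finally show ?thesis by simp
qed

lemma sum_card_fibres:
  assumes "finite A" "finite I" "\<And>a. a \<in> A \<Longrightarrow> f a \<in> I"
  shows "(\<Sum>i\<in>I. card {a\<in>A. f a = i}) = card A"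
  using assms sum.group[of A I f "\<lambda>_. 1 :: nat"] by (auto simp: image_subset_iff)

text \<open>The source of 1000. The worst case is \<open>p = 2\<close>, \<open>s = 1/3\<close>;
  since (4/5)^3 = 64/125 exceeds 1/2, the power is at most 4/5 and the quotient at most 9, below 10
  = \<open>1000 powr (1/3)\<close>.\<close>

lemma small_prime_factor_le:
  fixes p s :: real
  assumes "2 \<le> p" "1/3 \<le> s" "s \<le> 1/2"
  shows "(1 + p powr -s) / (1 - p powr -s) \<le> 1000 powr s"
proof -
  have "p powr -s \<le> 2 powr -s" using assms by (intro powr_mono2') auto
  also have "\<dots> \<le> 2 powr -(1/3)" using assms by (intro powr_mono) auto
  also have "\<dots> \<le> 4/5"
  proof -
    have "2 powr -(1/3) = (1/2 :: real) powr (1/3)" by (simp add: powr_minus powr_divide inverse_eq_divide)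
    also have "\<dots> \<le> ((4/5) ^ 3) powr (1/3)" by (intro powr_mono2) (auto simp: eval_nat_numeral)
    also have "\<dots> = (4/5 :: real)" by (simp add: powr_powr flip: powr_numeral)
    finally show ?thesis .
  qed
  finally have "(1 + p powr -s) / (1 - p powr -s) \<le> 10" by (simp add: field_simps)
  also have "(10 :: real) = (10 powr 3) powr (1/3)" by (simp only: powr_powr) simp
  also have "\<dots> = 1000 powr (1/3)" by simp
  also have "\<dots> \<le> 1000 powr s" using assms by (intro powr_mono) auto
  finally show ?thesis .
qed

subsection \<open>Induction on the set of primes\<close>

definition prime_divisors_of :: "nat set \<Rightarrow> nat set" where
  "prime_divisors_of S = {p. prime p \<and> (\<exists>s\<in>S. p dvd s)}"

lemma finite_prime_divisors_of:
  assumes "finite S" "0 \<notin> S"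
  shows "finite (prime_divisors_of S)"
proof (rule finite_subset)
  show "prime_divisors_of S \<subseteq> (\<Union>s\<in>S. {..s})"
  proof
    fix p assume "p \<in> prime_divisors_of S"
    then obtain s where "s \<in> S" "p dvd s" by (auto simp: prime_divisors_of_def)
    moreover from this have "p \<le> s" using assms by (metis dvd_imp_le gr0I)
    ultimately show "p \<in> (\<Union>s\<in>S. {..s})" by auto
  qed
qed (use assms in auto)

lemma prime_divisors_of_strip:
  "prime p \<Longrightarrow> prime_divisors_of (strip p i A \<union> strip p j B) \<subseteq> prime_divisors_of (A \<union> B) - {p}"
  by (auto simp: prime_divisors_of_def strip_def intro: dvd_mult)

lemma P_sml_strip:
  "prime p \<Longrightarrow> P_sml p0 (strip p i A \<union> strip p j B) \<subseteq> P_sml p0 (A \<union> B) - {p}"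
  by (auto simp: P_sml_def strip_def intro: dvd_mult)

lemma finite_strip:
  assumes "prime p" "finite A"
  shows "finite (strip p i A)"
proof -
  have "inj_on (\<lambda>m. p ^ i * m) (strip p i A)" using assms by (auto simp: inj_on_def)
  moreover have "(\<lambda>m. p ^ i * m) ` strip p i A \<subseteq> A" by (auto simp: strip_def)
  ultimately show ?thesis using assms(2) finite_subset finite_image_iff by metis
qed

text \<open>Cauchy's criterion for the convergent series of \<open>n powr \<sigma>\<close>: a finite
  sum over large numbers is dominated by a block of its tail. The absolute value covers either sign
  of \<open>C\<close>.\<close>

lemma exists_primes_tail_le:
  fixes \<sigma> C :: real
  assumes "\<sigma> < -1"
  obtains P0 :: real where
    "\<And>Q :: nat set. finite Q \<Longrightarrow> (\<And>p. p \<in> Q \<Longrightarrow> P0 \<le> real p) \<Longrightarrow> (\<Sum>p\<in>Q. C * real p powr \<sigma>) \<le> 1/2"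
proof -
  have "summable (\<lambda>n :: nat. \<bar>C\<bar> * real n powr \<sigma>)"
    using assms by (intro summable_mult) (simp add: summable_real_powr_iff)
  then obtain N where N: "\<And>m n. N \<le> m \<Longrightarrow> norm (\<Sum>n\<in>{m..<n}. \<bar>C\<bar> * real n powr \<sigma>) < 1/2"
    unfolding summable_Cauchy by (meson half_gt_zero zero_less_one)
  show thesis
  proof
    fix Q :: "nat set" assume Q: "finite Q" "\<And>p. p \<in> Q \<Longrightarrow> real N \<le> real p"
    have "(\<Sum>p\<in>Q. C * real p powr \<sigma>) \<le> (\<Sum>p\<in>Q. \<bar>C\<bar> * real p powr \<sigma>)"
      by (intro sum_mono mult_right_mono) auto
    also have "\<dots> \<le> (\<Sum>p\<in>{N..<Suc (Max Q)}. \<bar>C\<bar> * real p powr \<sigma>)"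
      using Q by (intro sum_mono2) (auto simp: less_Suc_eq_le)
    also have "\<dots> \<le> 1/2" using N[of N "Suc (Max Q)"] by simp
    finally show "(\<Sum>p\<in>Q. C * real p powr \<sigma>) \<le> 1/2" .
  qed
qed

text \<open>Schur's test for the kernel of \<open>card_fibre_le\<close> costs the factor
  \<open>(1 + t) / (1 - t)\<close>. It is at most \<open>1000 powr s\<close>, so it moves inside the
  power as a factor 1000 on \<open>C\<close>.\<close>

lemma gcd_bound_step:
  fixes p :: nat
  assumes s: "1/3 \<le> s" "s < 1/2" and p: "prime p" and C: "0 \<le> C"
    and fin: "finite A" "finite B" and 0: "0 \<notin> A" "0 \<notin> B"
    and IH: "\<And>i j. gcd_bound s C (strip p i A) (strip p j B)"
  shows "gcd_bound s (1000 * C) A B"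
  unfolding gcd_bound_def
proof (intro allI impI)
  fix E X Y D
  assume E: "E \<subseteq> A \<times> B" and pos: "0 < (X::real)" "0 < (Y::real)" "0 < (D::real)"
    and X: "\<forall>a\<in>A. real a \<le> X" and Y: "\<forall>b\<in>B. real b \<le> Y" and D: "\<forall>(a, b)\<in>E. D \<le> real (gcd a b)"
  define I where "I = multiplicity p ` (A \<union> B)"
  define t where "t = real p powr -s"
  define \<alpha> where "\<alpha> i = real (card {a\<in>A. multiplicity p a = i})" for i
  define \<beta> where "\<beta> j = real (card {b\<in>B. multiplicity p b = j})" for j
  define K where "K = X * Y / D\<^sup>2"
  have finE: "finite E" using E fin finite_subset by blast
  have I: "finite I" using fin by (simp add: I_def)
  have p2: "2 \<le> real p" using p prime_ge_2_nat by fastforce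
  have t: "0 \<le> t" "t < 1" using p2 s by (auto simp: t_def powr_less_one)
  have "card E = (\<Sum>i\<in>I. \<Sum>j\<in>I. card {(a, b)\<in>E. multiplicity p a = i \<and> multiplicity p b = j})"
    using finE I E by (intro card_fibres[symmetric]) (auto simp: I_def)
  then have "real (card E) = (\<Sum>i\<in>I. \<Sum>j\<in>I. real (card {(a, b)\<in>E. multiplicity p a = i \<and> multiplicity p b = j}))"
    by simp
  also have "\<dots> \<le> (\<Sum>i\<in>I. \<Sum>j\<in>I. (C * K) powr s * (t^(i-j) * t^(j-i) * (\<alpha> i * \<beta> j) powr (1 - s)))"
    unfolding K_def t_def \<alpha>_def \<beta>_def
    by (intro sum_mono card_fibre_le IH p 0 E pos C X Y D)
  also have "\<dots> = (C * K) powr s * (\<Sum>i\<in>I. \<Sum>j\<in>I. t^(i-j) * t^(j-i) * (\<alpha> i * \<beta> j) powr (1 - s))"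
    by (simp only: sum_distrib_left)
  also have "(\<Sum>i\<in>I. \<Sum>j\<in>I. t^(i-j) * t^(j-i) * (\<alpha> i * \<beta> j) powr (1 - s))
      \<le> (1 + t) / (1 - t) * (sum \<alpha> I * sum \<beta> I) powr (1 - s)"
  proof (rule schur_test_powr)
    fix j
    show "(\<Sum>i\<in>I. t^(i-j) * t^(j-i)) \<le> (1 + t) / (1 - t)"
      using sum_power_abs_diff_le(1)[OF I t, of j] by (simp add: mult.commute)
  qed (use I s t in \<open>auto intro!: sum_power_abs_diff_le simp: \<alpha>_def \<beta>_def\<close>)
  also have "sum \<alpha> I = card A"
    unfolding \<alpha>_def using fin I by (simp add: I_def sum_card_fibres flip: of_nat_sum)
  also have "sum \<beta> I = card B"
    unfolding \<beta>_def using fin I by (simp add: I_def sum_card_fibres flip: of_nat_sum)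
  also have "(C * K) powr s * ((1 + t) / (1 - t) * (real (card A) * real (card B)) powr (1 - s))
      \<le> (C * K) powr s * (1000 powr s * (real (card A) * real (card B)) powr (1 - s))"
    unfolding t_def using p2 s by (intro mult_left_mono mult_right_mono small_prime_factor_le) auto
  also have "\<dots> = (1000 * C * K) powr s * (real (card A) * real (card B)) powr (1 - s)"
  proof -
    have "(1000 * C * K) powr s = 1000 powr s * (C * K) powr s"
      using C pos powr_mult[of 1000 "C * K" s] by (simp add: K_def mult.assoc)
    then show ?thesis by simp
  qed
  finally show "real (card E) \<le> (1000 * C * (X * Y / D\<^sup>2)) powr s * (real (card A) * real (card B)) powr (1 - s)"
    by (simp add: K_def mult_left_mono)
qed

text \<open>The number of large primes is not controlled, so they must cost nothing: the constant 16
  is the same for the stripped sets and for \<open>A\<close>, \<open>B\<close>. All primes are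
  therefore treated together in one argument by contradiction.\<close>

lemma gcd_bound_large_primes:
  fixes s :: real
  assumes s: "0 < s" "s < 1/2"
  obtains P0 :: real where
    "\<And>A B. finite A \<Longrightarrow> finite B \<Longrightarrow> 0 \<notin> A \<Longrightarrow> 0 \<notin> B \<Longrightarrow>
      (\<And>p. p \<in> prime_divisors_of (A \<union> B) \<Longrightarrow> P0 \<le> real p) \<Longrightarrow>
      (\<And>p i j. p \<in> prime_divisors_of (A \<union> B) \<Longrightarrow> gcd_bound s 16 (strip p i A) (strip p j B)) \<Longrightarrow>
      gcd_bound s 16 A B"
proof -
  obtain P1 C :: real where conc: "\<And>p (I :: nat set) \<alpha> \<beta> e. P1 \<le> p \<Longrightarrow> finite I \<Longrightarrow>
      (\<And>i. i \<in> I \<Longrightarrow> 0 \<le> \<alpha> i) \<Longrightarrow> sum \<alpha> I = 1 \<Longrightarrow> (\<And>i. i \<in> I \<Longrightarrow> 0 \<le> \<beta> i) \<Longrightarrow> sum \<beta> I = 1 \<Longrightarrow>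
      (\<And>i j. i \<in> I \<Longrightarrow> j \<in> I \<Longrightarrow>
        e i j \<le> (p powr -s)^(i-j) * (p powr -s)^(j-i) * (\<alpha> i * \<beta> j) powr (1 - s)) \<Longrightarrow>
      (\<Sum>i\<in>I. \<Sum>j\<in>I. e i j) = 1 \<Longrightarrow>
      \<exists>k\<in>I. (\<Sum>i\<in>I-{k}. \<Sum>j\<in>I-{k}. e i j) \<le> C * p powr (-2 * (1 - s))"
    by (rule off_concentration_bound[OF s]) blast
  have "-2 * (1 - s) < -1" using s by simp
  then obtain P2 :: real where tail: "\<And>Q :: nat set. finite Q \<Longrightarrow> (\<And>p. p \<in> Q \<Longrightarrow> P2 \<le> real p) \<Longrightarrow>
      (\<Sum>p\<in>Q. C * real p powr (-2 * (1 - s))) \<le> 1/2"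
    by (rule exists_primes_tail_le[where C = C]) blast
  show thesis
  proof (rule that)
    fix A B :: "nat set"
    assume fin: "finite A" "finite B" and 0: "0 \<notin> A" "0 \<notin> B"
      and large: "\<And>p. p \<in> prime_divisors_of (A \<union> B) \<Longrightarrow> max P1 P2 \<le> real p"
      and IH: "\<And>p i j. p \<in> prime_divisors_of (A \<union> B) \<Longrightarrow> gcd_bound s 16 (strip p i A) (strip p j B)"
    show "gcd_bound s 16 A B"
      unfolding gcd_bound_def
    proof (intro allI impI, rule ccontr)
      fix E X Y D
      assume E: "E \<subseteq> A \<times> B" and pos: "0 < (X::real)" "0 < (Y::real)" "0 < (D::real)"
        and X: "\<forall>a\<in>A. real a \<le> X" and Y: "\<forall>b\<in>B. real b \<le> Y" and D: "\<forall>(a, b)\<in>E. D \<le> real (gcd a b)"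
      define K where "K = X * Y / D\<^sup>2"
      define L where "L = real (card A) * real (card B)"
      define Q where "Q = prime_divisors_of (A \<union> B)"
      assume "\<not> real (card E) \<le> (16 * (X * Y / D\<^sup>2)) powr s * (real (card A) * real (card B)) powr (1 - s)"
      then have contra: "(16 * K) powr s * L powr (1 - s) < card E" by (simp add: K_def L_def)
      have K0: "0 \<le> K" using pos by (simp add: K_def)
      have finE: "finite E" using E fin finite_subset by blast
      have Q: "finite Q" using fin 0 by (simp add: Q_def finite_prime_divisors_of)
      have E0: "0 < real (card E)"
        using contra by (meson le_less_trans mult_nonneg_nonneg powr_ge_zero)
      then have "A \<noteq> {}" "B \<noteq> {}" using E by auto
      then have AB: "0 < real (card A)" "0 < real (card B)" using fin by auto
      have "\<exists>k. real (card {(a, b)\<in>E. multiplicity p a \<noteq> k \<and> multiplicity p b \<noteq> k})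
          \<le> card E * (C * real p powr (-2 * (1 - s)))" if pQ: "p \<in> Q" for p
      proof -
        have p: "prime p" using pQ by (simp add: Q_def prime_divisors_of_def)
        define I where "I = multiplicity p ` (A \<union> B)"
        define t where "t = real p powr -s"
        define F where "F i j = {(a, b)\<in>E. multiplicity p a = i \<and> multiplicity p b = j}" for i j
        define \<alpha> where "\<alpha> i = real (card {a\<in>A. multiplicity p a = i}) / card A" for i
        define \<beta> where "\<beta> j = real (card {b\<in>B. multiplicity p b = j}) / card B" for j
        define e where "e i j = real (card (F i j)) / card E" for i j
        have I: "finite I" using fin by (simp add: I_def)
        \<comment> \<open>The failed bound says that \<open>(16 * K) powr s * L powr (1 - s)\<close>
          is below \<open>card E\<close>; dividing the fibre estimate by \<open>card E\<close> gives
          the hypothesis of \<open>conc\<close>.\<close>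
        have "e i j \<le> t^(i-j) * t^(j-i) * (\<alpha> i * \<beta> j) powr (1 - s)" for i j
        proof -
          have L: "real (card {a\<in>A. multiplicity p a = i}) * real (card {b\<in>B. multiplicity p b = j})
              = L * (\<alpha> i * \<beta> j)"
            using AB by (simp add: L_def \<alpha>_def \<beta>_def)
          have "real (card (F i j)) \<le> (16 * K) powr s * (t^(i-j) * t^(j-i) *
            (real (card {a\<in>A. multiplicity p a = i}) * real (card {b\<in>B. multiplicity p b = j})) powr (1 - s))"
            unfolding F_def K_def t_def
            using pQ by (intro card_fibre_le IH p 0 E pos X Y D) (auto simp: Q_def)
          also have "\<dots> = (16 * K) powr s * L powr (1 - s) * (t^(i-j) * t^(j-i) * (\<alpha> i * \<beta> j) powr (1 - s))"
            unfolding L by (subst powr_mult) (auto simp: L_def \<alpha>_def \<beta>_def)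
          also have "\<dots> \<le> card E * (t^(i-j) * t^(j-i) * (\<alpha> i * \<beta> j) powr (1 - s))"
            using contra by (intro mult_right_mono) (auto simp: t_def)
          finally show ?thesis using E0 by (simp add: e_def field_simps)
        qed
        moreover have "sum \<alpha> I = 1"
        proof -
          have "(\<Sum>i\<in>I. card {a\<in>A. multiplicity p a = i}) = card A"
            using fin I by (intro sum_card_fibres) (auto simp: I_def)
          then show ?thesis using AB unfolding \<alpha>_def
            by (simp flip: sum_divide_distrib of_nat_sum)
        qed
        moreover have "sum \<beta> I = 1"
        proof -
          have "(\<Sum>i\<in>I. card {a\<in>B. multiplicity p a = i}) = card B"
            using fin I by (intro sum_card_fibres) (auto simp: I_def)
          then show ?thesis using AB unfolding \<beta>_def
            by (simp flip: sum_divide_distrib of_nat_sum)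
        qed
        moreover have "(\<Sum>i\<in>I. \<Sum>j\<in>I. e i j) = 1"
        proof -
          have "(\<Sum>i\<in>I. \<Sum>j\<in>I. card (F i j)) = card E"
            unfolding F_def using finE I E by (intro card_fibres) (auto simp: I_def)
          then show ?thesis using E0 unfolding e_def
            by (simp flip: sum_divide_distrib of_nat_sum)
        qed
        ultimately obtain k where k: "k \<in> I"
          "(\<Sum>i\<in>I-{k}. \<Sum>j\<in>I-{k}. e i j) \<le> C * real p powr (-2 * (1 - s))"
          using conc[of "real p" I \<alpha> \<beta> e] large[of p] pQ I
          by (auto simp: Q_def t_def \<alpha>_def \<beta>_def)
        define G where "G = {(a, b)\<in>E. multiplicity p a \<noteq> k \<and> multiplicity p b \<noteq> k}"
        have "(\<Sum>i\<in>I-{k}. \<Sum>j\<in>I-{k}. card (F i j))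
            = (\<Sum>i\<in>I-{k}. \<Sum>j\<in>I-{k}. card {(a, b)\<in>G. multiplicity p a = i \<and> multiplicity p b = j})"
          by (intro sum.cong refl arg_cong[where f = card]) (auto simp: F_def G_def)
        also have "\<dots> = card G"
          using finE I E by (intro card_fibres) (auto simp: I_def G_def intro: finite_subset[OF _ finE])
        finally have "real (card G) = (\<Sum>i\<in>I-{k}. \<Sum>j\<in>I-{k}. card E * e i j)"
          using E0 by (simp add: e_def flip: of_nat_sum)
        also have "\<dots> = card E * (\<Sum>i\<in>I-{k}. \<Sum>j\<in>I-{k}. e i j)"
          by (simp only: sum_distrib_left)
        also have "\<dots> \<le> card E * (C * real p powr (-2 * (1 - s)))"
          using k(2) by (intro mult_left_mono) auto
        finally show ?thesis unfolding G_def by blast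
      qed
      then have "\<exists>k. \<forall>p\<in>Q. real (card {(a, b)\<in>E. multiplicity p a \<noteq> k p \<and> multiplicity p b \<noteq> k p})
          \<le> card E * (C * real p powr (-2 * (1 - s)))"
        by (intro bchoice ballI)
      then obtain k where k: "\<forall>p\<in>Q. real (card {(a, b)\<in>E. multiplicity p a \<noteq> k p \<and> multiplicity p b \<noteq> k p})
          \<le> card E * (C * real p powr (-2 * (1 - s)))"
        by (elim exE)
      define G where "G p = {(a, b)\<in>E. multiplicity p a \<noteq> k p \<and> multiplicity p b \<noteq> k p}" for p
      \<comment> \<open>On \<open>E'\<close> at least one endpoint has valuation \<open>k p\<close>
        at every \<open>p\<close> in \<open>Q\<close>, and \<open>N\<close> collects these exponents
        into one integer.\<close>
      define E' where "E' = E - (\<Union>p\<in>Q. G p)"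
      define N where "N = (\<Prod>p\<in>Q. p ^ k p)"
      have Qp: "prime p" if "p \<in> Q" for p using that by (simp add: Q_def prime_divisors_of_def)
      have N0: "0 < N" using Qp by (auto simp: N_def prime_gt_0_nat intro!: prod_pos)
      have "real (card (\<Union>p\<in>Q. G p)) \<le> (\<Sum>p\<in>Q. real (card (G p)))"
        using card_UN_le[OF Q, of G] by (simp flip: of_nat_sum)
      also have "\<dots> \<le> (\<Sum>p\<in>Q. card E * (C * real p powr (-2 * (1 - s))))"
        unfolding G_def by (intro sum_mono bspec[OF k])
      also have "\<dots> = card E * (\<Sum>p\<in>Q. C * real p powr (-2 * (1 - s)))"
        by (simp only: sum_distrib_left)
      also have "\<dots> \<le> card E * (1/2)"
        using large by (intro mult_left_mono tail Q) (auto simp: Q_def)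
      finally have removed: "real (card (\<Union>p\<in>Q. G p)) \<le> card E / 2" by simp
      have "(\<Union>p\<in>Q. G p) \<subseteq> E" by (auto simp: G_def)
      then have "card E' = card E - card (\<Union>p\<in>Q. G p)" "card (\<Union>p\<in>Q. G p) \<le> card E"
        unfolding E'_def using finE by (auto intro: card_Diff_subset card_mono finite_subset)
      then have half: "real (card E) \<le> 2 * card E'" using removed by linarith
      have "real (card E') \<le> 2 * sqrt (K * (card A * card B))"
        unfolding K_def
      proof (rule card_edges_structured_le[where N = N])
        fix a b p assume ab: "(a, b) \<in> E'" and p: "prime (p::nat)"
        have mN: "multiplicity p N = (if p \<in> Q then k p else 0)"
          unfolding N_def using Q Qp p by (intro multiplicity_prod_prime_powers) auto
        show "multiplicity p a = multiplicity p N \<or> multiplicity p b = multiplicity p N"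
        proof (cases "p \<in> Q")
          case True
          then show ?thesis using ab mN by (auto simp: E'_def G_def)
        next
          \<comment> \<open>Such a prime divides neither \<open>a\<close> nor \<open>N\<close>, so
            both valuations are 0.\<close>
          case False
          moreover have "a \<in> A" using ab E by (auto simp: E'_def)
          ultimately have "\<not> p dvd a" using p by (auto simp: Q_def prime_divisors_of_def)
          then show ?thesis using False mN by (simp add: not_dvd_imp_multiplicity_0)
        qed
      next
        fix a b assume "(a, b) \<in> E'"
        then show "D \<le> real (gcd a b)" using D by (auto simp: E'_def)
      qed (use fin E 0 X Y pos N0 in \<open>auto simp: E'_def intro: gr0I\<close>)
      then have up: "real (card E) \<le> 4 * sqrt (K * L)" using half by (simp add: L_def)
      have "card E \<le> card (A \<times> B)" using E fin by (intro card_mono) auto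
      then have upL: "real (card E) \<le> L" by (simp add: L_def card_cartesian_product flip: of_nat_mult)
      \<comment> \<open>The constant 16 is the square of 4: one factor 2 comes from the structured
        count and one from deleting up to half of the edges.\<close>
      have "4 * sqrt (K * L) = (16 * K * L) powr (1/2)"
        using K0 AB by (simp add: powr_half_sqrt real_sqrt_mult L_def)
      then have "real (card E) powr (2 * s) \<le> ((16 * K * L) powr (1/2)) powr (2 * s)"
        using up s by (intro powr_mono2) auto
      also have "\<dots> = (16 * K) powr s * L powr s"
        using powr_mult[of "16 * K" L s] by (simp add: powr_powr)
      finally have *: "real (card E) powr (2 * s) \<le> (16 * K) powr s * L powr s" .
      \<comment> \<open>Interpolation between the structured bound, used with weight
        \<open>2 * s\<close>, and the trivial bound \<open>L\<close>, used with weight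
        \<open>1 - 2 * s\<close>; the exponents of \<open>L\<close> add up to
        \<open>1 - s\<close>.\<close>
      have "real (card E) = real (card E) powr (2 * s) * real (card E) powr (1 - 2 * s)"
        using E0 by (simp flip: powr_add)
      also have "\<dots> \<le> ((16 * K) powr s * L powr s) * L powr (1 - 2 * s)"
        using * upL s E0 by (intro mult_mono powr_mono2) auto
      also have "\<dots> = (16 * K) powr s * L powr (1 - s)"
        by (simp add: algebra_simps flip: powr_add)
      finally show False using contra by simp
    qed
  qed
qed

text \<open>Strong induction on the number of prime divisors, which stripping any of them lowers.
  While a small prime remains it is stripped at the cost of a factor 1000. Once none is left,
  stripped sets have none either, so the constant stays 16 and the large-prime argument
  applies.\<close>

lemma gcd_bound_P_sml:
  fixes s :: real
  assumes s: "1/3 \<le> s" "s < 1/2"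
  obtains P0 :: real where
    "\<And>p0 A B. P0 \<le> p0 \<Longrightarrow> finite A \<Longrightarrow> finite B \<Longrightarrow> 0 \<notin> A \<Longrightarrow> 0 \<notin> B \<Longrightarrow>
      gcd_bound s (16 * 1000 ^ card (P_sml p0 (A \<union> B))) A B"
proof -
  have "0 < s" using s by simp
  then obtain P0 :: real where large: "\<And>A B. finite A \<Longrightarrow> finite B \<Longrightarrow> 0 \<notin> A \<Longrightarrow> 0 \<notin> B \<Longrightarrow>
      (\<And>p. p \<in> prime_divisors_of (A \<union> B) \<Longrightarrow> P0 \<le> real p) \<Longrightarrow>
      (\<And>p i j. p \<in> prime_divisors_of (A \<union> B) \<Longrightarrow> gcd_bound s 16 (strip p i A) (strip p j B)) \<Longrightarrow>
      gcd_bound s 16 A B"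
    by (rule gcd_bound_large_primes[OF _ s(2)]) blast
  have main: "gcd_bound s (16 * 1000 ^ card (P_sml p0 (A \<union> B))) A B"
    if "P0 \<le> p0" "finite A" "finite B" "0 \<notin> A" "0 \<notin> B" for p0 A B
    using that
  proof (induction "card (prime_divisors_of (A \<union> B))" arbitrary: A B rule: less_induct)
    case less
    have fin: "finite (prime_divisors_of (A \<union> B))"
      using less.prems by (intro finite_prime_divisors_of) auto
    have sub: "P_sml p0 (A \<union> B) \<subseteq> prime_divisors_of (A \<union> B)"
      by (auto simp: P_sml_def prime_divisors_of_def)
    then have finP: "finite (P_sml p0 (A \<union> B))" using fin finite_subset by blast
    have IH: "gcd_bound s (16 * 1000 ^ card (P_sml p0 (strip p i A \<union> strip p j B))) (strip p i A) (strip p j B)"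
      if pQ: "p \<in> prime_divisors_of (A \<union> B)" for p i j
    proof (rule less.hyps)
      have p: "prime p" using pQ by (simp add: prime_divisors_of_def)
      show "card (prime_divisors_of (strip p i A \<union> strip p j B)) < card (prime_divisors_of (A \<union> B))"
        using prime_divisors_of_strip[OF p, of i A j B] pQ fin by (intro psubset_card_mono) auto
      show "finite (strip p i A)" "finite (strip p j B)"
        using p less.prems by (auto intro: finite_strip)
      show "0 \<notin> strip p i A" "0 \<notin> strip p j B" by (auto simp: strip_def)
    qed (use less.prems in auto)
    show ?case
    proof (cases "P_sml p0 (A \<union> B) = {}")
      case True
      have "gcd_bound s 16 A B"
      proof (rule large)
        fix p assume p: "p \<in> prime_divisors_of (A \<union> B)"
        then have "\<not> real p \<le> p0" using True by (auto simp: P_sml_def prime_divisors_of_def)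
        then show "P0 \<le> real p" using less.prems(1) by simp
        fix i j
        have "P_sml p0 (strip p i A \<union> strip p j B) = {}"
          using P_sml_strip[of p p0 i A j B] True p by (auto simp: prime_divisors_of_def)
        then show "gcd_bound s 16 (strip p i A) (strip p j B)" using IH[OF p, of i j] by simp
      qed (use less.prems in auto)
      then show ?thesis using True by simp
    next
      case False
      then obtain p where p: "p \<in> P_sml p0 (A \<union> B)" by auto
      then have pp: "prime p" and pQ: "p \<in> prime_divisors_of (A \<union> B)"
        using sub by (auto simp: P_sml_def)
      define c where "c = card (P_sml p0 (A \<union> B)) - 1"
      have c: "card (P_sml p0 (A \<union> B)) = Suc c"
        using card_Suc_Diff1[OF finP p] p finP by (simp add: c_def)
      have "gcd_bound s (1000 * (16 * 1000 ^ c)) A B"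
      proof (rule gcd_bound_step[OF s pp])
        fix i j
        \<comment> \<open>Stripping may remove further small primes besides \<open>p\<close>, so
          only an inequality holds and the constant is raised by
          \<open>gcd_bound_mono\<close>.\<close>
        have "card (P_sml p0 (strip p i A \<union> strip p j B)) \<le> card (P_sml p0 (A \<union> B) - {p})"
          using finP P_sml_strip[OF pp] by (intro card_mono) auto
        also have "\<dots> = c" using p finP by (simp add: c_def)
        finally show "gcd_bound s (16 * 1000 ^ c) (strip p i A) (strip p j B)"
          using s by (intro gcd_bound_mono[OF IH[OF pQ]]) (auto intro: power_increasing)
      qed (use less.prems in auto)
      then show ?thesis by (simp add: c mult_ac)
    qed
  qed
  show thesis by (rule that) (rule main)
qed

section \<open>From edge counts to the product of the set sizes\<close>

theorem theorem1p1:
  fixes \<epsilon> :: real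
  assumes "0 < \<epsilon>" and "\<epsilon> < 1"
  shows "\<exists>P0::real. \<forall>p0\<ge>P0.
    \<forall>(X::real) (Y::real) (D::real) (\<delta>::real) (A::nat set) (B::nat set).
      1 \<le> X \<longrightarrow> 1 \<le> Y \<longrightarrow> 1 \<le> D \<longrightarrow> D \<le> min X Y \<longrightarrow> 0 < \<delta> \<longrightarrow> \<delta> \<le> 1 \<longrightarrow>
      (\<forall>a\<in>A. X \<le> real a \<and> real a \<le> 2 * X) \<longrightarrow>
      (\<forall>b\<in>B. Y \<le> real b \<and> real b \<le> 2 * Y) \<longrightarrow>
      \<delta> * real (card A) * real (card B)
        \<le> real (card {(a, b) \<in> A \<times> B. D \<le> real (gcd a b)}) \<longrightarrow>
      real (card A) * real (card B)
        \<le> 1000 ^ (1 + card (P_sml p0 (A \<union> B))) * \<delta> powr (- 2 - \<epsilon>) * (X * Y / D\<^sup>2)"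
proof -
  define s where "s = 1 / (2 + \<epsilon>)"
  have s: "1/3 \<le> s" "s < 1/2" using assms by (auto simp: s_def field_simps)
  obtain P0 :: real where P0: "\<And>p0 A B. P0 \<le> p0 \<Longrightarrow> finite A \<Longrightarrow> finite B \<Longrightarrow> 0 \<notin> A \<Longrightarrow> 0 \<notin> B \<Longrightarrow>
      gcd_bound s (16 * 1000 ^ card (P_sml p0 (A \<union> B))) A B"
    by (rule gcd_bound_P_sml[OF s]) blast
  show ?thesis
  proof (intro exI[of _ P0] allI impI)
    fix p0 X Y D \<delta> :: real and A B :: "nat set"
    assume p0: "P0 \<le> p0" and XYD: "1 \<le> X" "1 \<le> Y" "1 \<le> D" and \<delta>: "0 < \<delta>"
      and A: "\<forall>a\<in>A. X \<le> real a \<and> real a \<le> 2 * X" and B: "\<forall>b\<in>B. Y \<le> real b \<and> real b \<le> 2 * Y"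
      and E: "\<delta> * real (card A) * real (card B) \<le> real (card {(a, b) \<in> A \<times> B. D \<le> real (gcd a b)})"
    define n where "n = card (P_sml p0 (A \<union> B))"
    define K where "K = X * Y / D\<^sup>2"
    define L where "L = real (card A) * real (card B)"
    have fin: "finite A" "finite B"
      using A B by (auto intro!: finite_subset[of A "{..nat \<lfloor>2 * X\<rfloor>}"] finite_subset[of B "{..nat \<lfloor>2 * Y\<rfloor>}"]
        simp: le_nat_floor)
    have "0 \<notin> A" "0 \<notin> B" using A B XYD by force+
    then have "gcd_bound s (16 * 1000 ^ n) A B" unfolding n_def using P0 p0 fin by blast
    then have "real (card {(a, b) \<in> A \<times> B. D \<le> real (gcd a b)})
        \<le> (16 * 1000 ^ n * (2 * X * (2 * Y) / D\<^sup>2)) powr s * L powr (1 - s)"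
      unfolding L_def by (rule gcd_boundD) (use A B XYD in auto)
    \<comment> \<open>The upper ends \<open>2 * X\<close> and \<open>2 * Y\<close> contribute 4,
      giving 64; the additional 1 in the exponent of 1000 covers this.\<close>
    also have "16 * 1000 ^ n * (2 * X * (2 * Y) / D\<^sup>2) = 64 * 1000 ^ n * K" by (simp add: K_def)
    finally have le: "\<delta> * L \<le> (64 * 1000 ^ n * K) powr s * L powr (1 - s)"
      using E by (simp add: L_def mult.assoc)
    have K0: "0 \<le> K" using XYD by (simp add: K_def)
    have "L \<le> 64 * 1000 ^ n * K * \<delta> powr (- 2 - \<epsilon>)"
    proof (cases "L = 0")
      case False
      moreover have "0 \<le> L" by (simp add: L_def)
      ultimately have L0: "L > 0" by simp
      then have "L powr s * L powr (1 - s) = L" by (simp flip: powr_add)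
      with le have "(\<delta> * L powr s) * L powr (1 - s) \<le> (64 * 1000 ^ n * K) powr s * L powr (1 - s)"
        by (simp add: mult.assoc)
      then have "\<delta> * L powr s \<le> (64 * 1000 ^ n * K) powr s" using L0 by simp
      \<comment> \<open>Raising to the power \<open>2 + \<epsilon> = 1 / s\<close> isolates
        \<open>L\<close> and produces the exponent of \<open>\<delta>\<close>.\<close>
      then have "(\<delta> * L powr s) powr (2 + \<epsilon>) \<le> ((64 * 1000 ^ n * K) powr s) powr (2 + \<epsilon>)"
        using \<delta> assms by (intro powr_mono2) auto
      moreover have "s * (2 + \<epsilon>) = 1" using assms by (simp add: s_def)
      ultimately have "\<delta> powr (2 + \<epsilon>) * L \<le> 64 * 1000 ^ n * K"
        using \<delta> L0 K0 by (simp add: powr_mult powr_powr)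
      then have "L \<le> 64 * 1000 ^ n * K * (1 / \<delta> powr (2 + \<epsilon>))"
        using \<delta> by (simp add: field_simps)
      also have "1 / \<delta> powr (2 + \<epsilon>) = \<delta> powr (- 2 - \<epsilon>)"
        using powr_minus_divide[of \<delta> "2 + \<epsilon>"] by simp
      finally show ?thesis .
    qed (use K0 in auto)
    also have "\<dots> \<le> 1000 * 1000 ^ n * K * \<delta> powr (- 2 - \<epsilon>)"
      using K0 by (intro mult_right_mono) auto
    finally show "real (card A) * real (card B)
        \<le> 1000 ^ (1 + card (P_sml p0 (A \<union> B))) * \<delta> powr (- 2 - \<epsilon>) * (X * Y / D\<^sup>2)"
      by (simp add: L_def K_def n_def mult_ac)
  qed
qed

end
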